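(* The following statements are equivalent over $\mathsf{RCA}_0$: (i) $\mathsf{RWKL}$; (ii) $\mathsf{RSAT}$; (iii) $\mathsf{LRSAT}$; (iv) r.e.-$\mathsf{RSAT}$; (v) r.e.-$\mathsf{LRSAT}$.
   Context: $\mathsf{RCA}_0$ is the subsystem of second-order arithmetic axiomatized by the basic axioms of arithmetic, $\Sigma^0_1$ induction and $\Delta^0_1$ comprehension. $\mathbb{N}$ denotes the first-order part of a possibly nonstandard model. A tree is a set of finite strings closed under initial segments. A set $H \subseteq \mathbb{N}$ is homogeneous for $\sigma \in 2^{<\mathbb{N}}$ if $(\exists c < 2)(\forall i \in H)(i < |\sigma| \rightarrow \sigma(i) = c)$, and $H$ is homogeneous for an infinite tree $T \subseteq 2^{<\mathbb{N}}$ if the tree $\{\sigma \in T : H \text{ is homogeneous for } \sigma\}$ is infinite. $\mathsf{RWKL}$ is the statement "for every infinite tree $T \subseteq 2^{<\mathbb{N}}$, there is an infinite $H \subseteq \mathbb{N}$ that is homogeneous for $T$." A set $C$ of propositional formulas is finitely satisfiable if every finite $C_0 \subseteq C$ has a satisfying truth assignment. $\mathrm{atoms}(C)$ denotes the set of propositional atoms appearing in the formulas in $C$; by convention it is always assumed that $\mathrm{atoms}(C)$ exists as a set (which can be arranged in $\mathsf{RCA}_0$ by renaming atoms), and similarly for the set $\mathrm{atoms}((\varphi_i)_{i \in \mathbb{N}})$ of atoms appearing in a list of formulas. A set $H \subseteq \mathrm{atoms}(C)$ is homogeneous for $C$ if there is a truth value $c \in \{\mathtt{T}, \mathtt{F}\}$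 such that every finite $C_0 \subseteq C$ is satisfiable by a truth assignment $\nu$ such that $(\forall a \in H)(\nu(a) = c)$. $\mathsf{RSAT}$ is the statement "for every finitely satisfiable set $C$ of propositional formulas with $\mathrm{atoms}(C)$ infinite, there is an infinite $H \subseteq \mathrm{atoms}(C)$ that is homogeneous for $C$." $\mathsf{LRSAT}$ is the statement "for every finitely satisfiable set $C$ of propositional formulas with $\mathrm{atoms}(C)$ infinite and every infinite $X \subseteq \mathrm{atoms}(C)$, there is an infinite $H \subseteq X$ that is homogeneous for $C$." The statements r.e.-$\mathsf{RSAT}$ and r.e.-$\mathsf{LRSAT}$ are obtained from $\mathsf{RSAT}$ and $\mathsf{LRSAT}$, respectively, by replacing the finitely satisfiable set $C$ by a list (sequence) of propositional formulas $(\varphi_i)_{i \in \mathbb{N}}$ such that $\{\varphi_i : i < n\}$ is satisfiable for every $n \in \mathbb{N}$; in this case homogeneity of $H$ means that there is a truth value $c$ such that for every $n$, $\{\varphi_i : i < n\}$ is satisfiable by a truth assignment $\nu$ with $(\forall a \in H)(\nu(a) = c)$. *)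

theory Defs
  imports Main
begin

text \<open>
  Structures for the language of second-order arithmetic, with the general (Henkin) semantics.
  The number variables range over the type \<open>'a\<close>, which may well be nonstandard, and the set
  variables range over the family \<open>Sets\<close>.
\<close>

record 'a l2_structure =
  zero :: 'a ("\<zero>\<index>")
  one :: 'a ("\<one>\<index>")
  plus :: "'a \<Rightarrow> 'a \<Rightarrow> 'a" (infixl "\<oplus>\<index>" 65)
  times :: "'a \<Rightarrow> 'a \<Rightarrow> 'a" (infixl "\<otimes>\<index>" 70)
  less :: "'a \<Rightarrow> 'a \<Rightarrow> bool" (infix "\<prec>\<index>" 50)
  Sets :: "'a set set" ("\<S>\<index>")

section \<open>The axioms\<close>

text \<open>
  Syntax of the bounded quantifier formulas, with free number and set variables.  \<open>BAll t \<theta>\<close> is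
  the quantification over all \<open>x < t\<close>; it uses de Bruijn indices, so \<open>x\<close> is variable \<open>0\<close> in
  \<open>\<theta>\<close>, and \<open>t\<close> cannot refer to it.  The remaining connectives and the bounded existential
  quantifier are definable by negation.
\<close>

datatype tm = Var nat | Zero | One | Plus tm tm | Times tm tm

datatype bfm =
    Eq tm tm
  | Less tm tm
  | Mem tm nat
  | Neg bfm
  | Conj bfm bfm
  | BAll tm bfm

context
  fixes M :: "'a l2_structure" (structure)
begin

primrec tm_val :: "(nat \<Rightarrow> 'a) \<Rightarrow> tm \<Rightarrow> 'a" where
  "tm_val e (Var k) = e k"
| "tm_val e Zero = \<zero>"
| "tm_val e One = \<one>"
| "tm_val e (Plus s t) = tm_val e s \<oplus> tm_val e t"
| "tm_val e (Times s t) = tm_val e s \<otimes> tm_val e t"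

primrec bfm_holds :: "(nat \<Rightarrow> 'a set) \<Rightarrow> (nat \<Rightarrow> 'a) \<Rightarrow> bfm \<Rightarrow> bool" where
  "bfm_holds E e (Eq s t) \<longleftrightarrow> tm_val e s = tm_val e t"
| "bfm_holds E e (Less s t) \<longleftrightarrow> tm_val e s \<prec> tm_val e t"
| "bfm_holds E e (Mem t k) \<longleftrightarrow> tm_val e t \<in> E k"
| "bfm_holds E e (Neg \<theta>) \<longleftrightarrow> \<not> bfm_holds E e \<theta>"
| "bfm_holds E e (Conj \<theta> \<psi>) \<longleftrightarrow> bfm_holds E e \<theta> \<and> bfm_holds E e \<psi>"
| "bfm_holds E e (BAll t \<theta>) \<longleftrightarrow>
     (\<forall>x. x \<prec> tm_val e t \<longrightarrow> bfm_holds E (case_nat x e) \<theta>)"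

text \<open>
  In the formulas \<open>\<exists>n. \<theta>(n, x, \<dots>)\<close> and \<open>\<forall>n. \<theta>(n, x, \<dots>)\<close> below, \<open>n\<close> is variable \<open>0\<close> of \<open>\<theta>\<close>,
  \<open>x\<close> is variable \<open>1\<close>, and the further variables are parameters.
\<close>

definition sigma1_holds :: "bfm \<Rightarrow> (nat \<Rightarrow> 'a set) \<Rightarrow> (nat \<Rightarrow> 'a) \<Rightarrow> 'a \<Rightarrow> bool" where
  "sigma1_holds \<theta> E e x \<longleftrightarrow> (\<exists>n. bfm_holds E (case_nat n (case_nat x e)) \<theta>)"

definition pi1_holds :: "bfm \<Rightarrow> (nat \<Rightarrow> 'a set) \<Rightarrow> (nat \<Rightarrow> 'a) \<Rightarrow> 'a \<Rightarrow> bool" where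
  "pi1_holds \<theta> E e x \<longleftrightarrow> (\<forall>n. bfm_holds E (case_nat n (case_nat x e)) \<theta>)"

definition basic_axioms :: bool where
  "basic_axioms \<longleftrightarrow>
     (\<forall>m. m \<oplus> \<one> \<noteq> \<zero>) \<and>
     (\<forall>m n. m \<oplus> \<one> = n \<oplus> \<one> \<longrightarrow> m = n) \<and>
     (\<forall>m. m \<oplus> \<zero> = m) \<and>
     (\<forall>m n. m \<oplus> (n \<oplus> \<one>) = (m \<oplus> n) \<oplus> \<one>) \<and>
     (\<forall>m. m \<otimes> \<zero> = \<zero>) \<and>
     (\<forall>m n. m \<otimes> (n \<oplus> \<one>) = m \<otimes> n \<oplus> m) \<and>
     (\<forall>m. \<not> m \<prec> \<zero>) \<and>
     (\<forall>m n. m \<prec> n \<oplus> \<one> \<longleftrightarrow> m \<prec> n \<or> m = n)"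

definition sigma1_induction :: bool where
  "sigma1_induction \<longleftrightarrow> (\<forall>\<phi> E e. (\<forall>k. E k \<in> \<S>) \<longrightarrow>
     sigma1_holds \<phi> E e \<zero> \<longrightarrow>
     (\<forall>x. sigma1_holds \<phi> E e x \<longrightarrow> sigma1_holds \<phi> E e (x \<oplus> \<one>)) \<longrightarrow>
     (\<forall>x. sigma1_holds \<phi> E e x))"

definition delta1_comprehension :: bool where
  "delta1_comprehension \<longleftrightarrow> (\<forall>\<phi> \<psi> E e. (\<forall>k. E k \<in> \<S>) \<longrightarrow>
     (\<forall>x. sigma1_holds \<phi> E e x \<longleftrightarrow> pi1_holds \<psi> E e x) \<longrightarrow>
     (\<exists>X\<in>\<S>. \<forall>x. x \<in> X \<longleftrightarrow> sigma1_holds \<phi> E e x))"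

text \<open>
  \<open>RCA0\<close> says that \<open>M\<close> is a model of the theory.  That the set sort is nonempty is part of the
  notion of a two-sorted structure; it also makes sure that there are assignments \<open>E\<close> above.
\<close>

definition RCA0 :: bool where
  "RCA0 \<longleftrightarrow> \<S> \<noteq> {} \<and> basic_axioms \<and> sigma1_induction \<and> delta1_comprehension"

section \<open>Coding\<close>

text \<open>
  From here on, every definition is to be read inside the structure: all quantifiers over numbers
  range over \<open>'a\<close> and all quantifiers over sets range over \<open>\<S>\<close>.  HOL sets of type \<open>'a set\<close> which
  are not required to be in \<open>\<S>\<close> only serve as names for definable classes.
\<close>

definition leq :: "'a \<Rightarrow> 'a \<Rightarrow> bool" (infix "\<preceq>" 50) where
  "m \<preceq> n \<longleftrightarrow> m \<prec> n \<or> m = n"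

definition divides :: "'a \<Rightarrow> 'a \<Rightarrow> bool" where
  "divides m n \<longleftrightarrow> (\<exists>q. n = m \<otimes> q)"

definition unbounded :: "'a set \<Rightarrow> bool" where
  "unbounded X \<longleftrightarrow> (\<forall>k. \<exists>x\<in>X. k \<preceq> x)"

definition finite_set :: "'a set \<Rightarrow> bool" where
  "finite_set X \<longleftrightarrow> X \<in> \<S> \<and> (\<exists>k. \<forall>x\<in>X. x \<prec> k)"

text \<open>Cantor's pairing function \<open>(i + j)(i + j + 1)/2 + i\<close>, a bijection in models of RCA0.\<close>

definition pair :: "'a \<Rightarrow> 'a \<Rightarrow> 'a" where
  "pair i j = (THE z. z \<oplus> z = (i \<oplus> j) \<otimes> (i \<oplus> j \<oplus> \<one>) \<oplus> (i \<oplus> i))"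

definition fst_of :: "'a \<Rightarrow> 'a" where
  "fst_of z = (THE i. \<exists>j. z = pair i j)"

definition snd_of :: "'a \<Rightarrow> 'a" where
  "snd_of z = (THE j. \<exists>i. z = pair i j)"

text \<open>
  The usual coding of finite sets of numbers by numbers: \<open>pair (pair k m) n\<close> represents the set
  of all \<open>i < k\<close> such that \<open>m(i + 1) + 1\<close> divides \<open>n\<close>, and the code of a finite set is the least
  number that represents it.
\<close>

definition elems :: "'a \<Rightarrow> 'a set" where
  "elems c = {i. i \<prec> fst_of (fst_of c) \<and>
                 divides (snd_of (fst_of c) \<otimes> (i \<oplus> \<one>) \<oplus> \<one>) (snd_of c)}"

definition set_code :: "'a \<Rightarrow> bool" where
  "set_code c \<longleftrightarrow> (\<forall>d. d \<prec> c \<longrightarrow> elems d \<noteq> elems c)"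

text \<open>
  A finite binary string \<open>\<sigma>\<close> is coded by the pair of its length and the code of the finite set
  \<open>{i. i < |\<sigma>| \<and> \<sigma>(i) = 1}\<close>.  Bits are Booleans, with \<open>True\<close> for \<open>1\<close>.
\<close>

definition len :: "'a \<Rightarrow> 'a" where
  "len s = fst_of s"

definition bit :: "'a \<Rightarrow> 'a \<Rightarrow> bool" where
  "bit s i \<longleftrightarrow> i \<in> elems (snd_of s)"

definition strings :: "'a set" where
  "strings = {s. set_code (snd_of s) \<and> (\<forall>i \<in> elems (snd_of s). i \<prec> len s)}"

definition initial_segment :: "'a \<Rightarrow> 'a \<Rightarrow> bool" where
  "initial_segment s t \<longleftrightarrow> s \<in> strings \<and> t \<in> strings \<and> len s \<preceq> len t \<and>
     (\<forall>i. i \<prec> len s \<longrightarrow> (bit s i \<longleftrightarrow> bit t i))"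

section \<open>The Ramsey-type weak Koenig's lemma\<close>

definition binary_tree :: "'a set \<Rightarrow> bool" where
  "binary_tree T \<longleftrightarrow> T \<subseteq> strings \<and> (\<forall>t\<in>T. \<forall>s. initial_segment s t \<longrightarrow> s \<in> T)"

definition homogeneous_string :: "'a set \<Rightarrow> 'a \<Rightarrow> bool" where
  "homogeneous_string H s \<longleftrightarrow> (\<exists>c. \<forall>i\<in>H. i \<prec> len s \<longrightarrow> bit s i = c)"

definition homogeneous_tree :: "'a set \<Rightarrow> 'a set \<Rightarrow> bool" where
  "homogeneous_tree H T \<longleftrightarrow> unbounded {s\<in>T. homogeneous_string H s}"

definition RWKL :: bool where
  "RWKL \<longleftrightarrow> (\<forall>T\<in>\<S>. binary_tree T \<and> unbounded T \<longrightarrow>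
     (\<exists>H\<in>\<S>. unbounded H \<and> homogeneous_tree H T))"

section \<open>Propositional formulas\<close>

text \<open>
  Every number codes exactly one propositional formula: since the pairing function is bijective,
  each number is of exactly one of the following forms, and the codes of the immediate subformulas
  are smaller than the code of the formula.
\<close>

definition five_times :: "'a \<Rightarrow> 'a" where
  "five_times x = x \<oplus> x \<oplus> x \<oplus> x \<oplus> x"

definition AtomF :: "'a \<Rightarrow> 'a" where
  "AtomF a = five_times a"

definition NotF :: "'a \<Rightarrow> 'a" where
  "NotF p = five_times p \<oplus> \<one>"

definition AndF :: "'a \<Rightarrow> 'a \<Rightarrow> 'a" where
  "AndF p q = five_times (pair p q) \<oplus> \<one> \<oplus> \<one>"

definition OrF :: "'a \<Rightarrow> 'a \<Rightarrow> 'a" where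
  "OrF p q = five_times (pair p q) \<oplus> \<one> \<oplus> \<one> \<oplus> \<one>"

definition ImpF :: "'a \<Rightarrow> 'a \<Rightarrow> 'a" where
  "ImpF p q = five_times (pair p q) \<oplus> \<one> \<oplus> \<one> \<oplus> \<one> \<oplus> \<one>"

text \<open>
  \<open>occurrence_set a Z\<close> states the recursion equations for the set \<open>Z\<close> of all formulas in which the
  atom \<open>a\<close> occurs.  In RCA0 there is exactly one such \<open>Z\<close>, by primitive recursion.
\<close>

definition occurrence_set :: "'a \<Rightarrow> 'a set \<Rightarrow> bool" where
  "occurrence_set a Z \<longleftrightarrow>
     (\<forall>b. AtomF b \<in> Z \<longleftrightarrow> b = a) \<and>
     (\<forall>p. NotF p \<in> Z \<longleftrightarrow> p \<in> Z) \<and>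
     (\<forall>p q. AndF p q \<in> Z \<longleftrightarrow> p \<in> Z \<or> q \<in> Z) \<and>
     (\<forall>p q. OrF p q \<in> Z \<longleftrightarrow> p \<in> Z \<or> q \<in> Z) \<and>
     (\<forall>p q. ImpF p q \<in> Z \<longleftrightarrow> p \<in> Z \<or> q \<in> Z)"

definition occurs :: "'a \<Rightarrow> 'a \<Rightarrow> bool" where
  "occurs a p \<longleftrightarrow> (\<exists>Z\<in>\<S>. occurrence_set a Z \<and> p \<in> Z)"

definition atoms :: "'a set \<Rightarrow> 'a set" where
  "atoms C = {a. \<exists>p\<in>C. occurs a p}"

text \<open>
  A truth assignment is given by the set \<open>\<nu> \<in> \<S>\<close> of the atoms to which it assigns true.
  \<open>evaluation \<nu> V\<close> states the recursion equations for the set \<open>V\<close> of the formulas true under \<open>\<nu>\<close>.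
  In RCA0 there is exactly one such \<open>V\<close>, by primitive recursion.
\<close>

definition evaluation :: "'a set \<Rightarrow> 'a set \<Rightarrow> bool" where
  "evaluation \<nu> V \<longleftrightarrow>
     (\<forall>a. AtomF a \<in> V \<longleftrightarrow> a \<in> \<nu>) \<and>
     (\<forall>p. NotF p \<in> V \<longleftrightarrow> p \<notin> V) \<and>
     (\<forall>p q. AndF p q \<in> V \<longleftrightarrow> p \<in> V \<and> q \<in> V) \<and>
     (\<forall>p q. OrF p q \<in> V \<longleftrightarrow> p \<in> V \<or> q \<in> V) \<and>
     (\<forall>p q. ImpF p q \<in> V \<longleftrightarrow> (p \<in> V \<longrightarrow> q \<in> V))"

definition satisfies :: "'a set \<Rightarrow> 'a set \<Rightarrow> bool" where
  "satisfies \<nu> C \<longleftrightarrow> (\<forall>p\<in>C. \<exists>V\<in>\<S>. evaluation \<nu> V \<and> p \<in> V)"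

definition satisfiable :: "'a set \<Rightarrow> bool" where
  "satisfiable C \<longleftrightarrow> (\<exists>\<nu>\<in>\<S>. satisfies \<nu> C)"

definition constant_on :: "'a set \<Rightarrow> 'a set \<Rightarrow> bool \<Rightarrow> bool" where
  "constant_on H \<nu> c \<longleftrightarrow> (\<forall>a\<in>H. (a \<in> \<nu>) = c)"

section \<open>The Ramsey-type satisfiability principles\<close>

definition finitely_satisfiable :: "'a set \<Rightarrow> bool" where
  "finitely_satisfiable C \<longleftrightarrow> (\<forall>C0. finite_set C0 \<and> C0 \<subseteq> C \<longrightarrow> satisfiable C0)"

definition homogeneous :: "'a set \<Rightarrow> 'a set \<Rightarrow> bool" where
  "homogeneous H C \<longleftrightarrow> (\<exists>c. \<forall>C0. finite_set C0 \<and> C0 \<subseteq> C \<longrightarrow>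
     (\<exists>\<nu>\<in>\<S>. satisfies \<nu> C0 \<and> constant_on H \<nu> c))"

text \<open>
  The hypothesis \<open>atoms C \<in> \<S>\<close> expresses the convention that the set of atoms always exists.
\<close>

definition RSAT :: bool where
  "RSAT \<longleftrightarrow> (\<forall>C\<in>\<S>. finitely_satisfiable C \<and> atoms C \<in> \<S> \<and> unbounded (atoms C) \<longrightarrow>
     (\<exists>H\<in>\<S>. unbounded H \<and> H \<subseteq> atoms C \<and> homogeneous H C))"

definition LRSAT :: bool where
  "LRSAT \<longleftrightarrow> (\<forall>C\<in>\<S>. finitely_satisfiable C \<and> atoms C \<in> \<S> \<and> unbounded (atoms C) \<longrightarrow>
     (\<forall>X\<in>\<S>. unbounded X \<and> X \<subseteq> atoms C \<longrightarrow>
       (\<exists>H\<in>\<S>. unbounded H \<and> H \<subseteq> X \<and> homogeneous H C)))"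

text \<open>A sequence of numbers is a set \<open>F \<in> \<S>\<close> of pairs that is the graph of a total function.\<close>

definition sequence :: "'a set \<Rightarrow> bool" where
  "sequence F \<longleftrightarrow> F \<in> \<S> \<and> (\<forall>i. \<exists>!p. pair i p \<in> F)"

definition terms :: "'a set \<Rightarrow> 'a set" where
  "terms F = {p. \<exists>i. pair i p \<in> F}"

definition terms_below :: "'a set \<Rightarrow> 'a \<Rightarrow> 'a set" where
  "terms_below F n = {p. \<exists>i. i \<prec> n \<and> pair i p \<in> F}"

definition list_satisfiable :: "'a set \<Rightarrow> bool" where
  "list_satisfiable F \<longleftrightarrow> (\<forall>n. satisfiable (terms_below F n))"

definition list_homogeneous :: "'a set \<Rightarrow> 'a set \<Rightarrow> bool" where
  "list_homogeneous H F \<longleftrightarrow> (\<exists>c. \<forall>n.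
     \<exists>\<nu>\<in>\<S>. satisfies \<nu> (terms_below F n) \<and> constant_on H \<nu> c)"

definition re_RSAT :: bool where
  "re_RSAT \<longleftrightarrow> (\<forall>F. sequence F \<and> list_satisfiable F \<and>
       atoms (terms F) \<in> \<S> \<and> unbounded (atoms (terms F)) \<longrightarrow>
     (\<exists>H\<in>\<S>. unbounded H \<and> H \<subseteq> atoms (terms F) \<and> list_homogeneous H F))"

definition re_LRSAT :: bool where
  "re_LRSAT \<longleftrightarrow> (\<forall>F. sequence F \<and> list_satisfiable F \<and>
       atoms (terms F) \<in> \<S> \<and> unbounded (atoms (terms F)) \<longrightarrow>
     (\<forall>X\<in>\<S>. unbounded X \<and> X \<subseteq> atoms (terms F) \<longrightarrow>
       (\<exists>H\<in>\<S>. unbounded H \<and> H \<subseteq> X \<and> list_homogeneous H F)))"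

end

end

theory Submission
  imports Defs
begin

text \<open>
  Four of the implications are soft.  A localized principle gives the plain one when \<open>X\<close> is the set
  of all atoms, and a set of formulas can be listed as a sequence whose initial parts are finite
  sets.  So everything follows from the circle \<open>RWKL \<Longrightarrow> re_LRSAT \<Longrightarrow> \<dots> \<Longrightarrow> RSAT \<Longrightarrow> RWKL\<close>, of which the
  first and the last step have content.

  From \<open>RWKL\<close> to \<open>re_LRSAT\<close>.  An atom is at most as large as the code of any formula in which it
  occurs, so a string of length \<open>n\<close> decides every formula below \<open>n\<close>.  The strings \<open>s\<close> that satisfy
  all \<open>\<phi>\<^sub>i\<close> with \<open>i, \<phi>\<^sub>i < |s|\<close> form an infinite tree, and for a set \<open>H\<close> homogeneous for it, long
  strings in the tree that are constant on \<open>H\<close> are the required assignments.  To find \<open>H\<close> inside a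
  given infinite \<open>X\<close>, one applies \<open>RWKL\<close> to the tree of those \<open>s\<close> whose bit \<open>s(i)\<close> is the bit of
  some \<open>t \<in> T\<close> at the least element of \<open>X\<close> that is at least \<open>i\<close>, and pushes the solution forward
  along \<open>i \<mapsto> min {x \<in> X. i \<le> x}\<close> (\<open>RWKL_localized\<close>).

  From \<open>RSAT\<close> to \<open>RWKL\<close>.  Instead of writing down formulas that describe the tree \<open>T\<close>, let \<open>C\<close>
  consist of all formulas \<open>p\<close> that every \<open>t \<in> T\<close> of length \<open>p + 1\<close> satisfies.  This set exists by
  comprehension, long strings in \<open>T\<close> satisfy its finite parts, and by the instances of the excluded
  middle every number is an atom of it.  For every string \<open>s\<close> some formula says that the assignment
  does not extend \<open>s\<close> (\<open>excluding_formula_exists\<close>), and it lies in \<open>C\<close> if \<open>s \<notin> T\<close>.  As there are only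
  boundedly many strings of length \<open>n\<close>, an assignment satisfying a large enough finite part of \<open>C\<close>
  restricts to a string of length \<open>n\<close> in \<open>T\<close>; if it is constant on \<open>H\<close>, so is this string.

  All this takes place in an arbitrary model of the theory, where functions and predicates have to be
  shown to exist as sets.  A predicate on the model is called decidable if its extension is a set of
  the model, and a function is called computable if its graph is.  Once these classes are known to be
  closed under composition, bounded quantification and least search, every use of comprehension
  becomes an application of introduction rules.  The two other tools are that finite sets have codes
  below a computable bound (\<open>elems_exist\<close>), which makes quantification over strings of a given length
  bounded, and course-of-values recursion (\<open>set_recursion\<close>), which evaluates formulas.
\<close>

section \<open>Definability by bounded quantifier formulas\<close>

locale rca0_model =
  fixes M :: "'a l2_structure" (structure)
  assumes rca0: "RCA0 M"
begin

text \<open>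
  A predicate of environments stands for the formula that defines it, so that definability can be
  proved along the syntax of HOL terms, with the sets of the model as parameters.
\<close>

definition definable_term :: "((nat \<Rightarrow> 'a) \<Rightarrow> 'a) \<Rightarrow> bool" where
  "definable_term t \<longleftrightarrow> (\<exists>s. \<forall>e. t e = tm_val M e s)"

definition delta0 :: "((nat \<Rightarrow> 'a) \<Rightarrow> bool) \<Rightarrow> bool" where
  "delta0 P \<longleftrightarrow> (\<exists>\<theta> E. (\<forall>k. E k \<in> \<S>) \<and> (\<forall>e. P e \<longleftrightarrow> bfm_holds M E e \<theta>))"

lemma Sets_nonempty: "\<exists>E. \<forall>k::nat. E k \<in> \<S>"
  using rca0 by (auto simp: RCA0_def)

lemma definable_term_intros:
  "definable_term (\<lambda>e. e k)"
  "definable_term (\<lambda>e. \<zero>)"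
  "definable_term (\<lambda>e. \<one>)"
  "definable_term s \<Longrightarrow> definable_term t \<Longrightarrow> definable_term (\<lambda>e. s e \<oplus> t e)"
  "definable_term s \<Longrightarrow> definable_term t \<Longrightarrow> definable_term (\<lambda>e. s e \<otimes> t e)"
proof -
  show "definable_term (\<lambda>e. e k)"
    unfolding definable_term_def by (rule exI[of _ "Var k"]) simp
  show "definable_term (\<lambda>e. \<zero>)"
    unfolding definable_term_def by (rule exI[of _ Zero]) simp
  show "definable_term (\<lambda>e. \<one>)"
    unfolding definable_term_def by (rule exI[of _ One]) simp
  assume "definable_term s" "definable_term t"
  then obtain s' t' where *: "\<And>e. s e = tm_val M e s'" "\<And>e. t e = tm_val M e t'"
    by (auto simp: definable_term_def)
  show "definable_term (\<lambda>e. s e \<oplus> t e)"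
    unfolding definable_term_def by (rule exI[of _ "Plus s' t'"]) (simp add: *)
  show "definable_term (\<lambda>e. s e \<otimes> t e)"
    unfolding definable_term_def by (rule exI[of _ "Times s' t'"]) (simp add: *)
qed

text \<open>
  The two formulas in a conjunction come with their own set parameters.  They are moved to the even
  and the odd set variables.
\<close>

primrec rename_sets :: "(nat \<Rightarrow> nat) \<Rightarrow> bfm \<Rightarrow> bfm" where
  "rename_sets r (Eq s t) = Eq s t"
| "rename_sets r (Less s t) = Less s t"
| "rename_sets r (Mem t k) = Mem t (r k)"
| "rename_sets r (Neg \<theta>) = Neg (rename_sets r \<theta>)"
| "rename_sets r (Conj \<theta> \<psi>) = Conj (rename_sets r \<theta>) (rename_sets r \<psi>)"
| "rename_sets r (BAll t \<theta>) = BAll t (rename_sets r \<theta>)"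

lemma bfm_holds_rename_sets: "bfm_holds M E e (rename_sets r \<theta>) \<longleftrightarrow> bfm_holds M (E \<circ> r) e \<theta>"
  by (induction \<theta> arbitrary: e) auto

lemma delta0_common_parameters:
  assumes "delta0 P" "delta0 Q"
  obtains E \<theta> \<psi> where "\<And>k. E k \<in> \<S>" "\<And>e. P e \<longleftrightarrow> bfm_holds M E e \<theta>"
    "\<And>e. Q e \<longleftrightarrow> bfm_holds M E e \<psi>"
proof -
  obtain \<theta> E where 1: "\<And>k. E k \<in> \<S>" "\<And>e. P e \<longleftrightarrow> bfm_holds M E e \<theta>"
    using assms(1) by (auto simp: delta0_def)
  obtain \<psi> E' where 2: "\<And>k. E' k \<in> \<S>" "\<And>e. Q e \<longleftrightarrow> bfm_holds M E' e \<psi>"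
    using assms(2) by (auto simp: delta0_def)
  define F where "F k = (if even k then E (k div 2) else E' (k div 2))" for k
  have F: "F \<circ> (\<lambda>k. 2 * k) = E" "F \<circ> (\<lambda>k. 2 * k + 1) = E'"
    by (auto simp: F_def)
  show ?thesis
  proof
    show "F k \<in> \<S>" for k using 1(1) 2(1) by (simp add: F_def)
    show "P e \<longleftrightarrow> bfm_holds M F e (rename_sets (\<lambda>k. 2 * k) \<theta>)" for e
      by (simp only: bfm_holds_rename_sets F 1(2))
    show "Q e \<longleftrightarrow> bfm_holds M F e (rename_sets (\<lambda>k. 2 * k + 1) \<psi>)" for e
      by (simp only: bfm_holds_rename_sets F 2(2))
  qed
qed

lemma
  assumes "definable_term s" "definable_term t"
  shows delta0_Eq: "delta0 (\<lambda>e. s e = t e)" and delta0_Less: "delta0 (\<lambda>e. s e \<prec> t e)"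
proof -
  from assms obtain s' t' where *: "\<And>e. s e = tm_val M e s'" "\<And>e. t e = tm_val M e t'"
    by (auto simp: definable_term_def)
  obtain E :: "nat \<Rightarrow> 'a set" where E: "\<And>k. E k \<in> \<S>" using Sets_nonempty by blast
  show "delta0 (\<lambda>e. s e = t e)"
    unfolding delta0_def by (intro exI[of _ "Eq s' t'"] exI[of _ E]) (simp add: * E)
  show "delta0 (\<lambda>e. s e \<prec> t e)"
    unfolding delta0_def by (intro exI[of _ "Less s' t'"] exI[of _ E]) (simp add: * E)
qed

lemma delta0_Mem:
  assumes "definable_term s" "X \<in> \<S>"
  shows "delta0 (\<lambda>e. s e \<in> X)"
proof -
  obtain t where "\<And>e. s e = tm_val M e t" using assms(1) by (auto simp: definable_term_def)
  then show ?thesis unfolding delta0_def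
    by (intro exI[of _ "Mem t 0"] exI[of _ "\<lambda>_. X"]) (simp add: assms(2))
qed

lemma delta0_not: "delta0 P \<Longrightarrow> delta0 (\<lambda>e. \<not> P e)"
proof -
  assume "delta0 P"
  then obtain \<theta> E where "\<And>k. E k \<in> \<S>" "\<And>e. P e \<longleftrightarrow> bfm_holds M E e \<theta>"
    by (auto simp: delta0_def)
  then show ?thesis unfolding delta0_def
    by (intro exI[of _ "Neg \<theta>"] exI[of _ E]) simp
qed

lemma delta0_conj:
  assumes "delta0 P" "delta0 Q" shows "delta0 (\<lambda>e. P e \<and> Q e)"
proof -
  obtain E \<theta> \<psi> where "\<And>k. E k \<in> \<S>" "\<And>e. P e \<longleftrightarrow> bfm_holds M E e \<theta>"
    "\<And>e. Q e \<longleftrightarrow> bfm_holds M E e \<psi>" using delta0_common_parameters[OF assms] by auto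
  then show ?thesis unfolding delta0_def
    by (intro exI[of _ "Conj \<theta> \<psi>"] exI[of _ E]) simp
qed

lemma delta0_disj: assumes "delta0 P" "delta0 Q" shows "delta0 (\<lambda>e. P e \<or> Q e)"
proof -
  have "delta0 (\<lambda>e. \<not> (\<not> P e \<and> \<not> Q e))" by (intro delta0_not delta0_conj assms)
  then show ?thesis by (simp only: de_Morgan_conj not_not)
qed

lemma delta0_imp: assumes "delta0 P" "delta0 Q" shows "delta0 (\<lambda>e. P e \<longrightarrow> Q e)"
proof -
  have "delta0 (\<lambda>e. \<not> P e \<or> Q e)" by (intro delta0_not delta0_disj assms)
  then show ?thesis by (simp only: imp_conv_disj)
qed

text \<open>
  The bound variable becomes the head of the environment.  The conclusion is a higher-order pattern in
  \<open>P\<close>, so that the rule applies to concrete predicates by unification.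
\<close>

lemma delta0_all_less:
  assumes "definable_term t" "delta0 (\<lambda>e. P (e 0) (\<lambda>k. e (Suc k)))"
  shows "delta0 (\<lambda>e. \<forall>x. x \<prec> t e \<longrightarrow> P x e)"
proof -
  obtain s where s: "\<And>e. t e = tm_val M e s" using assms(1) by (auto simp: definable_term_def)
  obtain \<theta> E where E: "\<And>k. E k \<in> \<S>"
    and *: "\<And>e. P (e 0) (\<lambda>k. e (Suc k)) \<longleftrightarrow> bfm_holds M E e \<theta>"
    using assms(2) by (auto simp: delta0_def)
  have "P x e \<longleftrightarrow> bfm_holds M E (case_nat x e) \<theta>" for x e
    using *[of "case_nat x e"] by simp
  then show ?thesis unfolding delta0_def
    by (intro exI[of _ "BAll s \<theta>"] exI[of _ E]) (simp add: s E)
qed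

lemma delta0_ex_less:
  assumes "definable_term t" "delta0 (\<lambda>e. P (e 0) (\<lambda>k. e (Suc k)))"
  shows "delta0 (\<lambda>e. \<exists>x. x \<prec> t e \<and> P x e)"
  using delta0_not[OF delta0_all_less[of t "\<lambda>x e. \<not> P x e", OF assms(1) delta0_not[OF assms(2)]]]
  by simp

lemmas delta0_intros = delta0_ex_less delta0_all_less delta0_conj delta0_disj delta0_imp delta0_not
  delta0_Eq delta0_Less delta0_Mem definable_term_intros

text \<open>
  Two number parameters \<open>a\<close> and \<open>b\<close> serve the laws of arithmetic; anything more complicated is later
  reduced to this form by pairing.
\<close>

lemma delta0_sigma1_induct:
  assumes "delta0 (\<lambda>e. P (e 0) (e 1) (e 2) (e 3))"
    and "\<exists>n. P n \<zero> a b"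
    and "\<And>x n. P n x a b \<Longrightarrow> \<exists>n. P n (x \<oplus> \<one>) a b"
  shows "\<exists>n. P n x a b"
proof -
  obtain \<theta> E where E: "\<And>k. E k \<in> \<S>" and *: "\<And>e. P (e 0) (e 1) (e 2) (e 3) \<longleftrightarrow> bfm_holds M E e \<theta>"
    using assms(1) by (auto simp: delta0_def)
  define e where "e = case_nat a (\<lambda>_. b)"
  have **: "sigma1_holds M \<theta> E e y \<longleftrightarrow> (\<exists>n. P n y a b)" for y
    using *[of "case_nat n (case_nat y e)" for n] by (simp add: sigma1_holds_def e_def numeral_eq_Suc)
  have "sigma1_induction M" using rca0 by (simp add: RCA0_def)
  then have "sigma1_holds M \<theta> E e \<zero> \<longrightarrow>
      (\<forall>x. sigma1_holds M \<theta> E e x \<longrightarrow> sigma1_holds M \<theta> E e (x \<oplus> \<one>)) \<longrightarrow> (\<forall>x. sigma1_holds M \<theta> E e x)"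
    unfolding sigma1_induction_def using E by blast
  then show ?thesis using assms(2,3) unfolding ** by blast
qed

lemma delta0_induct:
  assumes "delta0 (\<lambda>e. P (e 1) (e 2) (e 3))"
    and "P \<zero> a b" and "\<And>x. P x a b \<Longrightarrow> P (x \<oplus> \<one>) a b"
  shows "P x a b"
  using delta0_sigma1_induct[of "\<lambda>_. P" a b x] assms by auto

lemma comprehension:
  assumes "delta0 (\<lambda>e. P (e 0) (e 1) (e 2))" "delta0 (\<lambda>e. Q (e 0) (e 1) (e 2))"
    and "\<And>x. (\<exists>n. P n x a) \<longleftrightarrow> (\<forall>n. Q n x a)"
  shows "{x. \<exists>n. P n x a} \<in> \<S>"
proof -
  from assms(1,2) obtain E \<theta> \<psi> where E: "\<And>k. E k \<in> \<S>"
    and P: "\<And>e. P (e 0) (e 1) (e 2) \<longleftrightarrow> bfm_holds M E e \<theta>"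
    and Q: "\<And>e. Q (e 0) (e 1) (e 2) \<longleftrightarrow> bfm_holds M E e \<psi>" by (rule delta0_common_parameters) blast
  define e :: "nat \<Rightarrow> 'a" where "e = (\<lambda>_. a)"
  have 1: "sigma1_holds M \<theta> E e x \<longleftrightarrow> (\<exists>n. P n x a)" for x
    using P[of "case_nat n (case_nat x e)" for n] by (simp add: sigma1_holds_def e_def numeral_eq_Suc)
  have 2: "pi1_holds M \<psi> E e x \<longleftrightarrow> (\<forall>n. Q n x a)" for x
    using Q[of "case_nat n (case_nat x e)" for n] by (simp add: pi1_holds_def e_def numeral_eq_Suc)
  have "Defs.delta1_comprehension M" using rca0 by (simp add: RCA0_def)
  then have "(\<forall>x. sigma1_holds M \<theta> E e x \<longleftrightarrow> pi1_holds M \<psi> E e x) \<longrightarrow>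
      (\<exists>X\<in>\<S>. \<forall>x. x \<in> X \<longleftrightarrow> sigma1_holds M \<theta> E e x)"
    using E unfolding delta1_comprehension_def by (elim allE[of _ \<theta>] allE[of _ \<psi>] allE[of _ E] allE[of _ e]) simp
  then obtain X where "X \<in> \<S>" "\<forall>x. x \<in> X \<longleftrightarrow> sigma1_holds M \<theta> E e x"
    using assms(3) unfolding 1 2 by blast
  moreover from this have "X = {x. \<exists>n. P n x a}" by (auto simp: 1)
  ultimately show ?thesis by simp
qed

section \<open>Arithmetic in the model\<close>

text \<open>
  The ring laws and the order are derived by quantifier-free induction, up to the point where the
  model is seen to be a discretely ordered semidomain.  From then on the laws come from the
  type class hierarchy.
\<close>

lemma basic: "basic_axioms M" using rca0 by (simp add: RCA0_def)

lemma add_one_neq_zero: "m \<oplus> \<one> \<noteq> \<zero>" using basic by (simp add: basic_axioms_def)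
lemma add_one_inject: "m \<oplus> \<one> = n \<oplus> \<one> \<longleftrightarrow> m = n" using basic unfolding basic_axioms_def by blast
lemma add_zero: "m \<oplus> \<zero> = m" using basic by (simp add: basic_axioms_def)
lemma add_add_one: "m \<oplus> (n \<oplus> \<one>) = (m \<oplus> n) \<oplus> \<one>" using basic by (simp add: basic_axioms_def)
lemma mult_zero: "m \<otimes> \<zero> = \<zero>" using basic by (simp add: basic_axioms_def)
lemma mult_add_one: "m \<otimes> (n \<oplus> \<one>) = m \<otimes> n \<oplus> m" using basic by (simp add: basic_axioms_def)
lemma not_less_zero: "\<not> m \<prec> \<zero>" using basic by (simp add: basic_axioms_def)
lemma less_add_one: "m \<prec> n \<oplus> \<one> \<longleftrightarrow> m \<prec> n \<or> m = n" using basic by (simp add: basic_axioms_def)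

lemma add_assoc': "(a \<oplus> b) \<oplus> x = a \<oplus> (b \<oplus> x)"
proof (rule delta0_induct[where P="\<lambda>x a b. (a \<oplus> b) \<oplus> x = a \<oplus> (b \<oplus> x)"])
  show "delta0 (\<lambda>e. e 2 \<oplus> e 3 \<oplus> e 1 = e 2 \<oplus> (e 3 \<oplus> e 1))" by (intro delta0_intros)
qed (simp_all add: add_zero add_add_one)

lemma zero_add: "\<zero> \<oplus> x = x"
  by (rule delta0_induct[where P="\<lambda>x a b. \<zero> \<oplus> x = x"], intro delta0_intros)
     (simp_all add: add_zero add_add_one)

lemma one_add: "\<one> \<oplus> x = x \<oplus> \<one>"
  by (rule delta0_induct[where P="\<lambda>x a b. \<one> \<oplus> x = x \<oplus> \<one>"], intro delta0_intros)
     (simp_all add: add_zero zero_add add_add_one)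

lemma add_commute': "a \<oplus> x = x \<oplus> a"
proof (rule delta0_induct[where P="\<lambda>x a b. a \<oplus> x = x \<oplus> a"])
  fix x assume *: "a \<oplus> x = x \<oplus> a"
  have "a \<oplus> (x \<oplus> \<one>) = x \<oplus> (\<one> \<oplus> a)" by (simp add: add_add_one * one_add)
  then show "a \<oplus> (x \<oplus> \<one>) = (x \<oplus> \<one>) \<oplus> a" by (simp only: add_assoc')
qed (intro delta0_intros, simp_all add: add_zero zero_add)

lemma add_left_commute': "a \<oplus> (b \<oplus> c) = b \<oplus> (a \<oplus> c)"
  by (metis add_assoc' add_commute')

lemma distrib_left': "a \<otimes> (b \<oplus> x) = a \<otimes> b \<oplus> a \<otimes> x"
  by (rule delta0_induct[where P="\<lambda>x a b. a \<otimes> (b \<oplus> x) = a \<otimes> b \<oplus> a \<otimes> x"], intro delta0_intros)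
     (simp_all add: add_zero mult_zero mult_add_one flip: add_assoc')

lemma zero_mult: "\<zero> \<otimes> x = \<zero>"
  by (rule delta0_induct[where P="\<lambda>x a b. \<zero> \<otimes> x = \<zero>"], intro delta0_intros)
     (simp_all add: add_zero mult_zero mult_add_one)

lemma mult_one: "x \<otimes> \<one> = x"
  using mult_add_one[of x \<zero>] by (simp add: zero_add mult_zero)

lemma distrib_right': "(a \<oplus> b) \<otimes> x = a \<otimes> x \<oplus> b \<otimes> x"
  by (rule delta0_induct[where P="\<lambda>x a b. (a \<oplus> b) \<otimes> x = a \<otimes> x \<oplus> b \<otimes> x"], intro delta0_intros)
     (simp_all add: mult_zero add_zero mult_add_one add_assoc' add_left_commute')

lemma one_mult: "\<one> \<otimes> x = x"
  by (rule delta0_induct[where P="\<lambda>x a b. \<one> \<otimes> x = x"], intro delta0_intros)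
     (simp_all add: mult_zero mult_add_one)

lemma mult_commute': "a \<otimes> x = x \<otimes> a"
  by (rule delta0_induct[where P="\<lambda>x a b. a \<otimes> x = x \<otimes> a"], intro delta0_intros)
     (simp_all add: mult_zero zero_mult mult_add_one distrib_right' one_mult)

lemma mult_assoc': "(a \<otimes> b) \<otimes> x = a \<otimes> (b \<otimes> x)"
  by (rule delta0_induct[where P="\<lambda>x a b. (a \<otimes> b) \<otimes> x = a \<otimes> (b \<otimes> x)"], intro delta0_intros)
     (simp_all add: mult_zero mult_add_one mult_one distrib_left')

lemma add_right_cancel': "a \<oplus> x = b \<oplus> x \<Longrightarrow> a = b"
  using delta0_induct[where P="\<lambda>x a b. a \<oplus> x = b \<oplus> x \<longrightarrow> a = b", of a b x]
  by (simp add: delta0_intros add_zero add_add_one add_one_inject)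

lemma zero_or_add_one: "x = \<zero> \<or> (\<exists>y. x = y \<oplus> \<one>)"
proof -
  have "\<exists>n. x = \<zero> \<or> x = n \<oplus> \<one>"
    by (rule delta0_sigma1_induct[where P="\<lambda>n x a b. x = \<zero> \<or> x = n \<oplus> \<one>"], intro delta0_intros) auto
  then show ?thesis by blast
qed

lemma less_iff_add_one: "a \<prec> b \<longleftrightarrow> (\<exists>d. b = a \<oplus> d \<oplus> \<one>)"
proof
  assume "a \<prec> b"
  moreover have "\<exists>n. a \<prec> b \<longrightarrow> b = a \<oplus> n \<oplus> \<one>"
  proof (rule delta0_sigma1_induct[where P="\<lambda>n x a b. a \<prec> x \<longrightarrow> x = a \<oplus> n \<oplus> \<one>"], intro delta0_intros)
    show "\<exists>n. a \<prec> x \<oplus> \<one> \<longrightarrow> x \<oplus> \<one> = a \<oplus> n \<oplus> \<one>" if "a \<prec> x \<longrightarrow> x = a \<oplus> n \<oplus> \<one>" for x n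
      using that by (metis less_add_one add_zero add_assoc')
  qed (simp add: not_less_zero)
  ultimately show "\<exists>d. b = a \<oplus> d \<oplus> \<one>" by blast
next
  assume "\<exists>d. b = a \<oplus> d \<oplus> \<one>"
  then obtain d where "b = a \<oplus> d \<oplus> \<one>" ..
  moreover have "a \<prec> a \<oplus> d \<oplus> \<one>"
    by (rule delta0_induct[where P="\<lambda>d a b. a \<prec> a \<oplus> d \<oplus> \<one>"], intro delta0_intros)
       (simp_all add: add_zero less_add_one add_add_one)
  ultimately show "a \<prec> b" by simp
qed


lemma less_irrefl': "\<not> x \<prec> x"
proof -
  have "x \<noteq> x \<oplus> d \<oplus> \<one>" for d
  proof
    assume "x = x \<oplus> d \<oplus> \<one>"
    then have "\<zero> \<oplus> x = (d \<oplus> \<one>) \<oplus> x" by (metis add_assoc' add_commute' zero_add)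
    then show False by (metis add_right_cancel' add_one_neq_zero)
  qed
  then show ?thesis by (simp add: less_iff_add_one)
qed

lemma less_trans': "x \<prec> y \<Longrightarrow> y \<prec> z \<Longrightarrow> x \<prec> z"
  by (metis less_iff_add_one add_assoc')

lemma leq_iff_add: "leq M a b \<longleftrightarrow> (\<exists>d. b = a \<oplus> d)"
  unfolding leq_def by (metis less_iff_add_one add_assoc' add_zero zero_or_add_one)

lemma less_linear': "x \<prec> y \<or> x = y \<or> y \<prec> x"
proof (rule delta0_induct[where P="\<lambda>x y b. x \<prec> y \<or> x = y \<or> y \<prec> x"])
  show "\<zero> \<prec> y \<or> \<zero> = y \<or> y \<prec> \<zero>"
    by (metis leq_iff_add leq_def zero_add)
  show "x \<oplus> \<one> \<prec> y \<or> x \<oplus> \<one> = y \<or> y \<prec> x \<oplus> \<one>" if "x \<prec> y \<or> x = y \<or> y \<prec> x" for x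
    using that
  proof (elim disjE)
    assume "x \<prec> y"
    then obtain d where "y = x \<oplus> \<one> \<oplus> d" by (metis less_iff_add_one add_assoc' add_commute')
    then show ?thesis by (metis leq_iff_add leq_def)
  qed (simp_all add: less_add_one)
qed (intro delta0_intros)

text \<open>
  Truncated subtraction, which the class of ordered semidomains asks for.
\<close>

definition minus :: "'a \<Rightarrow> 'a \<Rightarrow> 'a" (infixl "\<ominus>" 65) where
  "a \<ominus> b = (if \<exists>c. a = c \<oplus> b then THE c. a = c \<oplus> b else \<zero>)"

lemma minus_eqI: "a = c \<oplus> b \<Longrightarrow> a \<ominus> b = c"
  unfolding minus_def by (auto dest: add_right_cancel')

lemma minus_eq_zero: "a \<prec> b \<Longrightarrow> a \<ominus> b = \<zero>"
  unfolding minus_def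
  by (metis leq_iff_add leq_def add_commute' less_trans' less_irrefl')

abbreviation leq_in_model (infix "\<preceq>" 50) where "x \<preceq> y \<equiv> leq M x y"

lemma minus_cases:
  obtains "a \<prec> b" "a \<ominus> b = \<zero>" | c where "a = c \<oplus> b" "a \<ominus> b = c"
  by (metis less_linear' leq_iff_add leq_def add_commute' minus_eq_zero minus_eqI)

lemma mult_less_mono: "a \<prec> b \<Longrightarrow> \<zero> \<prec> c \<Longrightarrow> c \<otimes> a \<prec> c \<otimes> b"
proof -
  assume "a \<prec> b" "\<zero> \<prec> c"
  then obtain d e where "b = a \<oplus> d \<oplus> \<one>" and c: "c = \<zero> \<oplus> e \<oplus> \<one>" by (metis less_iff_add_one)
  then have "c \<otimes> b = c \<otimes> a \<oplus> (c \<otimes> d \<oplus> e) \<oplus> \<one>"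
    by (metis distrib_left' mult_one add_assoc' zero_add)
  then show ?thesis unfolding less_iff_add_one by blast
qed

lemma add_less_mono: "a \<prec> b \<Longrightarrow> c \<oplus> a \<prec> c \<oplus> b"
  unfolding less_iff_add_one by (metis add_assoc')

sublocale arith: discrete_linordered_semidom
  where plus = "\<lambda>a b. a \<oplus> b" and zero = \<zero> and minus = "\<lambda>a b. a \<ominus> b" and times = "\<lambda>a b. a \<otimes> b"
    and less_eq = "\<lambda>a b. a \<preceq> b" and less = "\<lambda>a b. a \<prec> b" and one = \<one>
proof
  show "a \<ominus> b \<ominus> c = a \<ominus> (b \<oplus> c)" for a b c
  proof (rule minus_cases[of a b])
    assume 1: "a \<prec> b" "a \<ominus> b = \<zero>"
    then have "a \<prec> b \<oplus> c" by (metis leq_iff_add leq_def less_trans')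
    moreover have "\<zero> \<ominus> c = \<zero>"
      by (metis leq_iff_add leq_def zero_add minus_eq_zero minus_eqI add_zero)
    ultimately show ?thesis using 1 minus_eq_zero by simp
  next
    fix d assume d: "a = d \<oplus> b" "a \<ominus> b = d"
    show ?thesis
    proof (rule minus_cases[of d c])
      assume "d \<prec> c" "d \<ominus> c = \<zero>"
      moreover from this have "a \<prec> b \<oplus> c" using d add_less_mono[of d c b] by (simp add: add_commute')
      ultimately show ?thesis using d by (metis minus_eq_zero)
    next
      fix e assume e: "d = e \<oplus> c" "d \<ominus> c = e"
      have "a \<ominus> (b \<oplus> c) = e" by (rule minus_eqI) (metis d(1) e(1) add_assoc' add_commute')
      then show ?thesis using d(2) e(2) by simp
    qed
  qed
  show "a \<otimes> (b \<ominus> c) = a \<otimes> b \<ominus> a \<otimes> c" for a b c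
  proof (rule minus_cases[of b c])
    assume "b \<prec> c" "b \<ominus> c = \<zero>"
    moreover have "a \<otimes> b \<ominus> a \<otimes> c = \<zero>"
    proof (cases "a = \<zero>")
      case True
      then show ?thesis by (simp add: zero_mult minus_eqI zero_add)
    next
      case False
      then have "\<zero> \<prec> a" by (metis less_linear' not_less_zero)
      then show ?thesis by (simp add: \<open>b \<prec> c\<close> mult_less_mono minus_eq_zero)
    qed
    ultimately show ?thesis by (simp add: mult_zero)
  next
    fix d assume "b = d \<oplus> c" "b \<ominus> c = d"
    then show ?thesis by (simp add: distrib_left' minus_eqI)
  qed
  show "a \<oplus> b \<ominus> a = b" for a b by (rule minus_eqI) (rule add_commute')
  show "(a \<prec> b) = (a \<preceq> b \<and> \<not> b \<preceq> a)" for a b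
    unfolding leq_def by (metis less_irrefl' less_trans')
  show "a \<otimes> b \<noteq> \<zero>" if "a \<noteq> \<zero>" "b \<noteq> \<zero>" for a b
    using that by (metis less_linear' not_less_zero mult_less_mono mult_zero)
  show "b \<preceq> a \<Longrightarrow> a \<ominus> b \<oplus> b = a" for a b
    by (metis leq_iff_add add_commute' minus_eqI)
  show "a \<preceq> b \<Longrightarrow> c \<oplus> a \<preceq> c \<oplus> b" for a b c
    unfolding leq_def by (auto simp: add_less_mono)
  show "a \<preceq> b \<Longrightarrow> b \<preceq> c \<Longrightarrow> a \<preceq> c" for a b c
    unfolding leq_def by (metis less_trans')
  show "a \<preceq> b \<Longrightarrow> b \<preceq> a \<Longrightarrow> a = b" for a b
    unfolding leq_def by (metis less_trans' less_irrefl')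
  show "a \<preceq> b \<or> b \<preceq> a" for a b
    unfolding leq_def by (metis less_linear')
  show "\<zero> \<prec> \<one>" by (metis less_add_one zero_add leq_iff_add leq_def)
  show "a \<prec> b \<longleftrightarrow> a \<oplus> \<one> \<preceq> b" for a b
    by (metis less_iff_add_one leq_iff_add add_assoc' add_commute')
  show "\<zero> \<noteq> \<one>" by (metis zero_add add_one_neq_zero)
  show "a \<prec> b \<Longrightarrow> \<zero> \<prec> c \<Longrightarrow> c \<otimes> a \<prec> c \<otimes> b" for a b c by (rule mult_less_mono)
qed (simp add: leq_def | rule add_assoc' mult_assoc' distrib_right' distrib_left' add_commute'
    mult_commute' zero_add one_mult zero_mult mult_zero)+

lemma less_add_one_iff: "m \<prec> n \<oplus> \<one> \<longleftrightarrow> m \<preceq> n"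
  by (simp add: less_add_one leq_def)

lemma zero_least [simp]: "\<zero> \<preceq> n"
  using not_less_zero arith.not_less by blast

section \<open>Pairing\<close>

(* Codes are defined by repeated addition of one, so such sums must not turn into numerals. *)
declare arith.one_add_one [simp del]
lemmas expand_simps = distrib_left' distrib_right' ac_simps

lemma double_inject: "x \<oplus> x = y \<oplus> y \<Longrightarrow> x = y"
  by (metis arith.add_strict_mono arith.neqE arith.less_irrefl)

lemma double_less: "x \<oplus> x \<prec> y \<oplus> y \<Longrightarrow> x \<prec> y"
  by (meson arith.add_mono arith.not_le)

text \<open>
  Twice a triangular number is \<open>s(s + 1)\<close>; adding \<open>s + 1\<close> gives the next one.
\<close>

lemma triangular_step:
  "t \<oplus> t = s \<otimes> (s \<oplus> \<one>) \<Longrightarrow> (t \<oplus> s \<oplus> \<one>) \<oplus> (t \<oplus> s \<oplus> \<one>) = (s \<oplus> \<one>) \<otimes> (s \<oplus> \<one> \<oplus> \<one>)"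
proof -
  assume *: "t \<oplus> t = s \<otimes> (s \<oplus> \<one>)"
  have "(t \<oplus> s \<oplus> \<one>) \<oplus> (t \<oplus> s \<oplus> \<one>) = (t \<oplus> t) \<oplus> (s \<oplus> s \<oplus> \<one> \<oplus> \<one>)" by (simp only: ac_simps)
  then show ?thesis unfolding * by (simp add: expand_simps)
qed

lemma even_mult_add_one: "\<exists>t. t \<oplus> t = s \<otimes> (s \<oplus> \<one>)"
proof (rule delta0_sigma1_induct[where P="\<lambda>t s a b. t \<oplus> t = s \<otimes> (s \<oplus> \<one>)"], intro delta0_intros)
  fix s t assume "t \<oplus> t = s \<otimes> (s \<oplus> \<one>)"
  then have "(t \<oplus> s \<oplus> \<one>) \<oplus> (t \<oplus> s \<oplus> \<one>) = (s \<oplus> \<one>) \<otimes> (s \<oplus> \<one> \<oplus> \<one>)"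
    by (metis (no_types) triangular_step)
  then show "\<exists>t. t \<oplus> t = (s \<oplus> \<one>) \<otimes> (s \<oplus> \<one> \<oplus> \<one>)" by blast
qed (auto intro: exI[of _ \<zero>])

abbreviation pairing ("\<langle>_,/ _\<rangle>") where "\<langle>i, j\<rangle> \<equiv> pair M i j"
abbreviation first where "first \<equiv> fst_of M"
abbreviation second where "second \<equiv> snd_of M"

lemma pair_iff: "z = \<langle>i, j\<rangle> \<longleftrightarrow> z \<oplus> z = (i \<oplus> j) \<otimes> (i \<oplus> j \<oplus> \<one>) \<oplus> (i \<oplus> i)"
proof -
  obtain t where "t \<oplus> t = (i \<oplus> j) \<otimes> (i \<oplus> j \<oplus> \<one>)" using even_mult_add_one by blast
  then have "(t \<oplus> i) \<oplus> (t \<oplus> i) = (i \<oplus> j) \<otimes> (i \<oplus> j \<oplus> \<one>) \<oplus> (i \<oplus> i)"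
    by (metis arith.add.assoc arith.add.commute)
  then have "(THE z. z \<oplus> z = (i \<oplus> j) \<otimes> (i \<oplus> j \<oplus> \<one>) \<oplus> (i \<oplus> i)) = t \<oplus> i"
    by (intro the_equality) (assumption, metis double_inject)
  then show ?thesis unfolding pair_def
    using \<open>t \<oplus> i \<oplus> (t \<oplus> i) = _\<close> by (metis double_inject)
qed

lemma pair_double: "\<langle>i, j\<rangle> \<oplus> \<langle>i, j\<rangle> = (i \<oplus> j) \<otimes> (i \<oplus> j \<oplus> \<one>) \<oplus> (i \<oplus> i)"
  using pair_iff by blast

text \<open>
  Cantor's function enumerates the diagonals \<open>i + j = s\<close> one after the other: the last value on a
  diagonal is still smaller than the first one on the next.
\<close>

lemma pair_less_of_sum_less:
  assumes "i \<oplus> j \<prec> i' \<oplus> j'" shows "\<langle>i, j\<rangle> \<prec> \<langle>i', j'\<rangle>"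
proof -
  define s where "s = i \<oplus> j"
  have i: "i \<prec> s \<oplus> \<one>" by (simp add: s_def less_add_one_iff)
  have "\<langle>i, j\<rangle> \<oplus> \<langle>i, j\<rangle> = s \<otimes> (s \<oplus> \<one>) \<oplus> (i \<oplus> i)"
    by (simp add: pair_double s_def)
  also have "\<dots> \<prec> s \<otimes> (s \<oplus> \<one>) \<oplus> ((s \<oplus> \<one>) \<oplus> (s \<oplus> \<one>))"
    using i by (intro arith.add_strict_left_mono arith.add_strict_mono)
  also have "\<dots> = (s \<oplus> \<one>) \<otimes> (s \<oplus> \<one> \<oplus> \<one>)" by (simp add: expand_simps)
  also have "\<dots> \<preceq> (i' \<oplus> j') \<otimes> (i' \<oplus> j' \<oplus> \<one>)"
    using assms unfolding arith.less_iff_succ_less_eq s_def by (intro arith.mult_mono) simp_all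
  also have "\<dots> \<preceq> \<langle>i', j'\<rangle> \<oplus> \<langle>i', j'\<rangle>" by (simp add: pair_double)
  finally show ?thesis by (rule double_less)
qed

lemma pair_inject [simp]: "\<langle>i, j\<rangle> = \<langle>i', j'\<rangle> \<longleftrightarrow> i = i' \<and> j = j'"
proof
  assume *: "\<langle>i, j\<rangle> = \<langle>i', j'\<rangle>"
  then have s: "i \<oplus> j = i' \<oplus> j'"
    by (metis arith.neqE arith.less_irrefl pair_less_of_sum_less)
  have "i \<oplus> i = i' \<oplus> i'" using pair_double[of i j] pair_double[of i' j'] unfolding * s by simp
  then have "i = i'" by (rule double_inject)
  with s show "i = i' \<and> j = j'" by simp
qed simp

text \<open>
  Every number is reached from \<open>\<langle>0, 0\<rangle>\<close> by walking along the diagonals, where \<open>(i, j + 1)\<close> is followed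
  by \<open>(i + 1, j)\<close>, and the end \<open>(i, 0)\<close> of a diagonal by the beginning \<open>(0, i + 1)\<close> of the next.
\<close>

lemma pair_surj: obtains i j where "z = \<langle>i, j\<rangle>"
proof -
  have "\<exists>n. \<exists>i. i \<prec> n \<and> (\<exists>j. j \<prec> n \<and> z \<oplus> z = (i \<oplus> j) \<otimes> (i \<oplus> j \<oplus> \<one>) \<oplus> (i \<oplus> i))"
  proof (rule delta0_sigma1_induct[where P="\<lambda>n z a b. \<exists>i. i \<prec> n \<and> (\<exists>j. j \<prec> n \<and> z \<oplus> z = (i \<oplus> j) \<otimes> (i \<oplus> j \<oplus> \<one>) \<oplus> (i \<oplus> i))"],
      intro delta0_intros)
    show "\<exists>n i. i \<prec> n \<and> (\<exists>j. j \<prec> n \<and> \<zero> \<oplus> \<zero> = (i \<oplus> j) \<otimes> (i \<oplus> j \<oplus> \<one>) \<oplus> (i \<oplus> i))"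
      by (rule exI[of _ \<one>], rule exI[of _ \<zero>]) (auto intro!: exI[of _ \<zero>])
  next
    fix z n
    assume "\<exists>i. i \<prec> n \<and> (\<exists>j. j \<prec> n \<and> z \<oplus> z = (i \<oplus> j) \<otimes> (i \<oplus> j \<oplus> \<one>) \<oplus> (i \<oplus> i))"
    then obtain i j where ij: "i \<prec> n" "j \<prec> n" "z \<oplus> z = (i \<oplus> j) \<otimes> (i \<oplus> j \<oplus> \<one>) \<oplus> (i \<oplus> i)" by blast
    have *: "\<exists>i j. i \<prec> n \<oplus> \<one> \<and> j \<prec> n \<oplus> \<one> \<and>
      (z \<oplus> \<one>) \<oplus> (z \<oplus> \<one>) = (i \<oplus> j) \<otimes> (i \<oplus> j \<oplus> \<one>) \<oplus> (i \<oplus> i)"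
    proof (cases "j = \<zero>")
      case True
      have "(z \<oplus> \<one>) \<oplus> (z \<oplus> \<one>) = (z \<oplus> z) \<oplus> \<one> \<oplus> \<one>" by (simp add: ac_simps)
      also have "\<dots> = (\<zero> \<oplus> (i \<oplus> \<one>)) \<otimes> (\<zero> \<oplus> (i \<oplus> \<one>) \<oplus> \<one>) \<oplus> (\<zero> \<oplus> \<zero>)"
        unfolding ij(3) True by (simp add: expand_simps)
      finally show ?thesis using ij(1,2) True less_add_one[of \<zero> n]
        by - (rule exI[of _ \<zero>], rule exI[of _ "i \<oplus> \<one>"], simp)
    next
      case False
      then obtain k where k: "j = k \<oplus> \<one>" using zero_or_add_one by blast
      have "k \<prec> n \<oplus> \<one>" using k ij(2) by (metis arith.less_trans less_add_one)
      have "(z \<oplus> \<one>) \<oplus> (z \<oplus> \<one>) = (z \<oplus> z) \<oplus> \<one> \<oplus> \<one>" by (simp add: ac_simps)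
      also have "\<dots> = ((i \<oplus> \<one>) \<oplus> k) \<otimes> ((i \<oplus> \<one>) \<oplus> k \<oplus> \<one>) \<oplus> ((i \<oplus> \<one>) \<oplus> (i \<oplus> \<one>))"
        unfolding ij(3) k by (simp add: expand_simps)
      finally show ?thesis using ij(1) \<open>k \<prec> n \<oplus> \<one>\<close>
        by - (rule exI[of _ "i \<oplus> \<one>"], rule exI[of _ k], simp)
    qed
    then show "\<exists>n i. i \<prec> n \<and> (\<exists>j. j \<prec> n \<and> (z \<oplus> \<one>) \<oplus> (z \<oplus> \<one>) = (i \<oplus> j) \<otimes> (i \<oplus> j \<oplus> \<one>) \<oplus> (i \<oplus> i))"
      by blast
  qed
  then show ?thesis using that pair_iff by blast
qed

lemma first_pair [simp]: "first \<langle>i, j\<rangle> = i" by (auto simp: fst_of_def)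
lemma second_pair [simp]: "second \<langle>i, j\<rangle> = j" by (auto simp: snd_of_def)
lemma pair_first_second [simp]: "\<langle>first z, second z\<rangle> = z"
  by (rule pair_surj[of z]) simp

lemma sum_le_pair: "i \<oplus> j \<oplus> i \<preceq> \<langle>i, j\<rangle>"
proof (rule ccontr)
  define s where "s = i \<oplus> j"
  assume "\<not> ?thesis"
  then have "\<langle>i, j\<rangle> \<oplus> \<langle>i, j\<rangle> \<prec> (s \<oplus> i) \<oplus> (s \<oplus> i)"
    by (simp add: s_def arith.not_le arith.add_strict_mono)
  also have "\<dots> = (s \<oplus> s) \<oplus> (i \<oplus> i)" by (simp add: ac_simps)
  also have "\<dots> \<preceq> s \<otimes> (s \<oplus> \<one>) \<oplus> (i \<oplus> i)"
  proof (cases "s = \<zero>")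
    case False
    then have "\<one> \<preceq> s" by (metis zero_or_add_one arith.le_add_same_cancel2 zero_least)
    then have "s \<otimes> \<one> \<preceq> s \<otimes> s" by (intro arith.mult_left_mono) simp_all
    then show ?thesis by (simp add: distrib_left')
  qed simp
  finally show False by (simp add: pair_double s_def)
qed

lemma first_le: "i \<preceq> \<langle>i, j\<rangle>" and second_le: "j \<preceq> \<langle>i, j\<rangle>"
proof -
  have "i \<preceq> i \<oplus> (j \<oplus> i)" "j \<preceq> j \<oplus> (i \<oplus> i)" by simp_all
  then have "i \<preceq> i \<oplus> j \<oplus> i" "j \<preceq> i \<oplus> j \<oplus> i" by (simp_all only: ac_simps)
  then show "i \<preceq> \<langle>i, j\<rangle>" "j \<preceq> \<langle>i, j\<rangle>" using sum_le_pair arith.order_trans by blast+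
qed

lemma pair_mono: "j \<preceq> j' \<Longrightarrow> \<langle>i, j\<rangle> \<preceq> \<langle>i, j'\<rangle>"
  by (metis arith.add_le_less_mono arith.add.commute arith.le_less pair_less_of_sum_less)

section \<open>Decidable predicates and computable functions\<close>

definition decidable :: "('a \<Rightarrow> bool) \<Rightarrow> bool" where
  "decidable P \<longleftrightarrow> {x. P x} \<in> \<S>"

definition graph :: "('a \<Rightarrow> 'a) \<Rightarrow> 'a set" where "graph f = {\<langle>x, f x\<rangle> |x. True}"

definition computable :: "('a \<Rightarrow> 'a) \<Rightarrow> bool" where
  "computable f \<longleftrightarrow> graph f \<in> \<S>"

lemma pair_in_graph [simp]: "\<langle>x, y\<rangle> \<in> graph f \<longleftrightarrow> y = f x" by (auto simp: graph_def)

lemma graph_in_Sets: "computable f \<Longrightarrow> graph f \<in> \<S>" by (simp add: computable_def)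

text \<open>
  Renaming of number variables allows to place an abstract definable predicate under quantifiers.
\<close>

primrec rename_tm :: "(nat \<Rightarrow> nat) \<Rightarrow> tm \<Rightarrow> tm" where
  "rename_tm r (Var k) = Var (r k)"
| "rename_tm r Zero = Zero"
| "rename_tm r One = One"
| "rename_tm r (Plus s t) = Plus (rename_tm r s) (rename_tm r t)"
| "rename_tm r (Times s t) = Times (rename_tm r s) (rename_tm r t)"

primrec rename_vars :: "(nat \<Rightarrow> nat) \<Rightarrow> bfm \<Rightarrow> bfm" where
  "rename_vars r (Eq s t) = Eq (rename_tm r s) (rename_tm r t)"
| "rename_vars r (Less s t) = Less (rename_tm r s) (rename_tm r t)"
| "rename_vars r (Mem t k) = Mem (rename_tm r t) k"
| "rename_vars r (Neg \<theta>) = Neg (rename_vars r \<theta>)"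
| "rename_vars r (Conj \<theta> \<psi>) = Conj (rename_vars r \<theta>) (rename_vars r \<psi>)"
| "rename_vars r (BAll t \<theta>) = BAll (rename_tm r t) (rename_vars (case_nat 0 (\<lambda>k. Suc (r k))) \<theta>)"

lemma tm_val_rename: "tm_val M e (rename_tm r t) = tm_val M (\<lambda>k. e (r k)) t"
  by (induction t) auto

lemma bfm_holds_rename_vars:
  "bfm_holds M E e (rename_vars r \<theta>) \<longleftrightarrow> bfm_holds M E (\<lambda>k. e (r k)) \<theta>"
proof (induction \<theta> arbitrary: e r)
  case (BAll t \<theta>)
  have "(\<lambda>k. case_nat x e (case_nat 0 (\<lambda>k. Suc (r k)) k)) = case_nat x (\<lambda>k. e (r k))" for x
    by (auto split: nat.split)
  then show ?case by (simp add: BAll tm_val_rename)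
qed (auto simp: tm_val_rename)

lemma delta0_rename: "delta0 P \<Longrightarrow> delta0 (\<lambda>e. P (\<lambda>k. e (r k)))"
  unfolding delta0_def using bfm_holds_rename_vars by metis

text \<open>
  A total function with a \<open>\<Sigma>\<^sup>0\<^sub>1\<close> graph has a \<open>\<Delta>\<^sup>0\<^sub>1\<close> graph: \<open>y\<close> is the value at \<open>x\<close> if no other value
  shows up.
\<close>

lemma computableI:
  assumes P: "delta0 (\<lambda>e. P (e 0) (e 1) (e 2) (e 3))"
    and f: "\<And>x y. f x = y \<longleftrightarrow> (\<exists>n. P n x y a)"
  shows "computable f"
proof -
  let ?pair = "\<lambda>z i j. z \<oplus> z = (i \<oplus> j) \<otimes> (i \<oplus> j \<oplus> \<one>) \<oplus> (i \<oplus> i)"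
  let ?Q = "\<lambda>n z a. \<exists>x. x \<prec> z \<oplus> \<one> \<and> (\<exists>y. y \<prec> z \<oplus> \<one> \<and> ?pair z x y \<and> P n x y a)"
  let ?R = "\<lambda>n z a. \<forall>x. x \<prec> z \<oplus> \<one> \<longrightarrow> (\<forall>y. y \<prec> z \<oplus> \<one> \<longrightarrow> ?pair z x y \<longrightarrow>
       (\<forall>y'. y' \<prec> n \<longrightarrow> (\<forall>n'. n' \<prec> n \<longrightarrow> P n' x y' a \<longrightarrow> y' = y)))"
  have [simp]: "?pair z x y \<longleftrightarrow> z = \<langle>x, y\<rangle>" for z x y using pair_iff by simp
  have bound: "x \<prec> \<langle>x, y\<rangle> \<oplus> \<one>" "y \<prec> \<langle>x, y\<rangle> \<oplus> \<one>" for x y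
    by (simp_all add: less_add_one_iff first_le second_le)
  have Q: "?Q n z a \<longleftrightarrow> (\<exists>x y. z = \<langle>x, y\<rangle> \<and> P n x y a)" for n z
    using bound by auto
  have R: "?R n z a \<longleftrightarrow> (\<forall>x y. z = \<langle>x, y\<rangle> \<longrightarrow>
       (\<forall>y'. y' \<prec> n \<longrightarrow> (\<forall>n'. n' \<prec> n \<longrightarrow> P n' x y' a \<longrightarrow> y' = y)))" for n z
    using bound by auto
  have "{z. \<exists>n. ?Q n z a} \<in> \<S>"
  proof (rule comprehension[where Q = ?R])
    have "delta0 (\<lambda>e. P (e 2) (e 1) (e 0) (e 4))"
      using delta0_rename[OF P, of "\<lambda>k. [2,1,0,4] ! k"] by (simp add: numeral_eq_Suc)
    then show "delta0 (\<lambda>e. ?Q (e 0) (e 1) (e 2))"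
      by (intro delta0_intros) (simp_all add: numeral_eq_Suc)
    have "delta0 (\<lambda>e. P (e 0) (e 3) (e 1) (e 6))"
      using delta0_rename[OF P, of "\<lambda>k. [0,3,1,6] ! k"] by (simp add: numeral_eq_Suc)
    then show "delta0 (\<lambda>e. ?R (e 0) (e 1) (e 2))"
      by (intro delta0_intros) (simp_all add: numeral_eq_Suc)
    show "(\<exists>n. ?Q n z a) \<longleftrightarrow> (\<forall>n. ?R n z a)" for z
    proof -
      obtain x y where z: "z = \<langle>x, y\<rangle>" by (rule pair_surj)
      have "(\<forall>n. ?R n z a) \<longleftrightarrow> (\<forall>y' n'. P n' x y' a \<longrightarrow> y' = y)"
        unfolding R z by (auto, metis arith.less_add_one arith.add_strict_increasing2 arith.le_less_trans arith.le_add_same_cancel1 arith.le_add_same_cancel2 less_add_one_iff zero_least)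
      also have "\<dots> \<longleftrightarrow> f x = y" using f by metis
      finally show ?thesis unfolding Q z using f by simp
    qed
  qed
  also have "{z. \<exists>n. ?Q n z a} = graph f"
    unfolding Q graph_def by (auto dest: f[THEN iffD2, OF exI]) (use f in blast)
  finally show ?thesis unfolding computable_def .
qed


lemma decidableI:
  assumes "delta0 (\<lambda>e. P (e 0) (e 1) (e 2))" "delta0 (\<lambda>e. Q (e 0) (e 1) (e 2))"
    and "\<And>x. R x \<longleftrightarrow> (\<exists>n. P n x a)" "\<And>x. R x \<longleftrightarrow> (\<forall>n. Q n x a)"
  shows "decidable R"
proof -
  have "{x. \<exists>n. P n x a} \<in> \<S>"
    by (rule comprehension[OF assms(1,2)]) (simp only: assms(3,4)[symmetric])
  then show ?thesis unfolding decidable_def assms(3) .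
qed

lemma decidableI_delta0:
  assumes "delta0 (\<lambda>e. P (e 1))" shows "decidable P"
  by (rule decidableI[where P="\<lambda>n x a. P x" and Q="\<lambda>n x a. P x"])
    (rule assms, rule assms, simp_all)

lemma exists_bound3: "\<exists>n. a \<prec> n \<and> b \<prec> n \<and> c \<prec> n"
proof (intro exI conjI)
  show "a \<prec> (a \<oplus> (b \<oplus> c)) \<oplus> \<one>" "b \<prec> (a \<oplus> (b \<oplus> c)) \<oplus> \<one>" "c \<prec> (a \<oplus> (b \<oplus> c)) \<oplus> \<one>"
    unfolding less_add_one_iff
    using arith.add_increasing arith.add_increasing2 by simp_all
qed

lemma exists_bound4: "\<exists>n. a \<prec> n \<and> b \<prec> n \<and> c \<prec> n \<and> d \<prec> n"
  by (meson exists_bound3 arith.less_trans)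

lemma computable_binary:
  assumes f: "computable f" and g: "computable g"
    and R: "delta0 (\<lambda>e. R (e 0) (e 1) (e 2))" "\<And>u v y. h u v = y \<longleftrightarrow> R u v y"
  shows "computable (\<lambda>x. h (f x) (g x))"
proof (rule computableI[where a=\<zero>])
  let ?pair = "\<lambda>z i j. z \<oplus> z = (i \<oplus> j) \<otimes> (i \<oplus> j \<oplus> \<one>) \<oplus> (i \<oplus> i)"
  let ?P = "\<lambda>n x y a. \<exists>u. u \<prec> n \<and> (\<exists>v. v \<prec> n \<and> (\<exists>p. p \<prec> n \<and> (\<exists>q. q \<prec> n \<and>
     (p \<in> graph f \<and> ?pair p x u) \<and> (q \<in> graph g \<and> ?pair q x v) \<and> R u v y)))"
  have "delta0 (\<lambda>e. R (e 3) (e 2) (e 6))"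
    using delta0_rename[OF R(1), of "\<lambda>k. [3,2,6] ! k"] by (simp add: numeral_eq_Suc)
  then show "delta0 (\<lambda>e. ?P (e 0) (e 1) (e 2) (e 3))"
    by (intro delta0_intros graph_in_Sets f g) (simp_all add: numeral_eq_Suc)
  have iff: "p \<in> graph f' \<and> ?pair p x u \<longleftrightarrow> p = \<langle>x, u\<rangle> \<and> u = f' x" for p x u f'
    unfolding pair_iff[symmetric] by auto
  show "h (f x) (g x) = y \<longleftrightarrow> (\<exists>n. ?P n x y \<zero>)" for x y
    unfolding iff R(2) using exists_bound4[of "f x" "g x" "\<langle>x, f x\<rangle>" "\<langle>x, g x\<rangle>"] by blast
qed

lemma computable_add: "computable f \<Longrightarrow> computable g \<Longrightarrow> computable (\<lambda>x. f x \<oplus> g x)"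
  by (rule computable_binary[where h="\<lambda>u v. u \<oplus> v" and R="\<lambda>u v y. u \<oplus> v = y"])
    (assumption+, intro delta0_intros, rule refl)

lemma computable_mult: "computable f \<Longrightarrow> computable g \<Longrightarrow> computable (\<lambda>x. f x \<otimes> g x)"
  by (rule computable_binary[where h="\<lambda>u v. u \<otimes> v" and R="\<lambda>u v y. u \<otimes> v = y"])
    (assumption+, intro delta0_intros, rule refl)

lemma computable_pair: "computable f \<Longrightarrow> computable g \<Longrightarrow> computable (\<lambda>x. \<langle>f x, g x\<rangle>)"
  by (rule computable_binary[where h="\<lambda>i j. \<langle>i, j\<rangle>" and R="\<lambda>i j z. z \<oplus> z = (i \<oplus> j) \<otimes> (i \<oplus> j \<oplus> \<one>) \<oplus> (i \<oplus> i)"])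
    (assumption+, intro delta0_intros, metis pair_iff)

lemma computable_id: "computable (\<lambda>x. x)"
  by (rule computableI[where P="\<lambda>n x y a. x = y"], intro delta0_intros) simp

lemma computable_const: "computable (\<lambda>x. c)"
  by (rule computableI[where P="\<lambda>n x y a. a = y" and a=c], intro delta0_intros) simp

lemma computable_compose:
  assumes f: "computable f" and g: "computable g"
  shows "computable (\<lambda>x. f (g x))"
proof (rule computableI[where a=\<zero>])
  let ?pair = "\<lambda>z i j. z \<oplus> z = (i \<oplus> j) \<otimes> (i \<oplus> j \<oplus> \<one>) \<oplus> (i \<oplus> i)"
  let ?P = "\<lambda>n x y a. \<exists>u. u \<prec> n \<and> (\<exists>p. p \<prec> n \<and> (\<exists>q. q \<prec> n \<and>
     (p \<in> graph g \<and> ?pair p x u) \<and> (q \<in> graph f \<and> ?pair q u y)))"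
  show "delta0 (\<lambda>e. ?P (e 0) (e 1) (e 2) (e 3))"
    by (intro delta0_intros graph_in_Sets f g)
  have iff: "p \<in> graph f' \<and> ?pair p x u \<longleftrightarrow> p = \<langle>x, u\<rangle> \<and> u = f' x" for p x u f'
    unfolding pair_iff[symmetric] by auto
  show "f (g x) = y \<longleftrightarrow> (\<exists>n. ?P n x y \<zero>)" for x y
    unfolding iff using exists_bound3[of "g x" "\<langle>x, g x\<rangle>" "\<langle>g x, f (g x)\<rangle>"] by blast
qed

lemma computable_first: "computable first"
proof (rule computableI[where a=\<zero>])
  let ?P = "\<lambda>j z i a. z \<oplus> z = (i \<oplus> j) \<otimes> (i \<oplus> j \<oplus> \<one>) \<oplus> (i \<oplus> i)"
  show "delta0 (\<lambda>e. ?P (e 0) (e 1) (e 2) (e 3))" by (intro delta0_intros)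
  show "first z = i \<longleftrightarrow> (\<exists>j. ?P j z i \<zero>)" for z i
    unfolding pair_iff[symmetric] by (metis first_pair second_pair pair_first_second)
qed

lemma computable_second: "computable second"
proof (rule computableI[where a=\<zero>])
  let ?P = "\<lambda>i z j a. z \<oplus> z = (i \<oplus> j) \<otimes> (i \<oplus> j \<oplus> \<one>) \<oplus> (i \<oplus> i)"
  show "delta0 (\<lambda>e. ?P (e 0) (e 1) (e 2) (e 3))" by (intro delta0_intros)
  show "second z = i \<longleftrightarrow> (\<exists>j. ?P j z i \<zero>)" for z i
    unfolding pair_iff[symmetric] by (metis first_pair second_pair pair_first_second)
qed

lemmas computable_intros = computable_const computable_id computable_add computable_mult
  computable_pair computable_compose[OF computable_first] computable_compose[OF computable_second]

lemma decidable_compose: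
  assumes P: "decidable P" and f: "computable f"
  shows "decidable (\<lambda>x. P (f x))"
proof (rule decidableI[where a=\<zero>])
  let ?pair = "\<lambda>z i j. z \<oplus> z = (i \<oplus> j) \<otimes> (i \<oplus> j \<oplus> \<one>) \<oplus> (i \<oplus> i)"
  let ?Q = "\<lambda>n x a. \<exists>u. u \<prec> n \<oplus> \<one> \<and> (n \<in> graph f \<and> ?pair n x u) \<and> u \<in> {u. P u}"
  let ?R = "\<lambda>n x a. \<forall>u. u \<prec> n \<oplus> \<one> \<longrightarrow> (n \<in> graph f \<and> ?pair n x u) \<longrightarrow> u \<in> {u. P u}"
  have X: "{u. P u} \<in> \<S>" using P by (simp add: decidable_def)
  show "delta0 (\<lambda>e. ?Q (e 0) (e 1) (e 2))" by (intro delta0_intros graph_in_Sets f X)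
  show "delta0 (\<lambda>e. ?R (e 0) (e 1) (e 2))" by (intro delta0_intros graph_in_Sets f X)
  have iff: "p \<in> graph f' \<and> ?pair p x u \<longleftrightarrow> p = \<langle>x, u\<rangle> \<and> u = f' x" for p x u f'
    unfolding pair_iff[symmetric] by auto
  show "P (f x) \<longleftrightarrow> (\<exists>n. ?Q n x \<zero>)" "P (f x) \<longleftrightarrow> (\<forall>n. ?R n x \<zero>)" for x
    unfolding iff by (auto simp: less_add_one_iff second_le)
qed

lemma decidable_Mem: "X \<in> \<S> \<Longrightarrow> computable f \<Longrightarrow> decidable (\<lambda>x. f x \<in> X)"
  using decidable_compose[of "\<lambda>x. x \<in> X"] by (simp add: decidable_def)

lemma decidable_not: assumes "decidable P" shows "decidable (\<lambda>x. \<not> P x)"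
proof -
  have "decidable (\<lambda>x. x \<notin> {x. P x})"
    using assms by (intro decidableI_delta0 delta0_intros) (simp add: decidable_def)
  then show ?thesis by simp
qed

lemma decidable_const: "decidable (\<lambda>x. p)"
proof -
  have "decidable (\<lambda>x. x = x)" by (intro decidableI_delta0 delta0_intros)
  then show ?thesis using decidable_not[of "\<lambda>x. x = x"] by (cases p) simp_all
qed

lemma decidable_conj:
  assumes "decidable P" "decidable Q" shows "decidable (\<lambda>x. P x \<and> Q x)"
proof -
  have "decidable (\<lambda>x. x \<in> {x. P x} \<and> x \<in> {x. Q x})"
    using assms by (intro decidableI_delta0 delta0_intros) (simp_all add: decidable_def)
  then show ?thesis by simp
qed

lemma decidable_disj: assumes "decidable P" "decidable Q" shows "decidable (\<lambda>x. P x \<or> Q x)"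
proof -
  have "decidable (\<lambda>x. \<not> (\<not> P x \<and> \<not> Q x))" by (intro decidable_not decidable_conj assms)
  then show ?thesis by (simp only: de_Morgan_conj not_not)
qed

lemma decidable_imp: assumes "decidable P" "decidable Q" shows "decidable (\<lambda>x. P x \<longrightarrow> Q x)"
proof -
  have "decidable (\<lambda>x. \<not> P x \<or> Q x)" by (intro decidable_not decidable_disj assms)
  then show ?thesis by (simp only: imp_conv_disj)
qed

lemma decidable_iff: assumes "decidable P" "decidable Q" shows "decidable (\<lambda>x. P x \<longleftrightarrow> Q x)"
proof -
  have "decidable (\<lambda>x. (P x \<longrightarrow> Q x) \<and> (Q x \<longrightarrow> P x))" by (intro decidable_imp decidable_conj assms)
  then show ?thesis by (simp only: iff_conv_conj_imp)
qed

lemma decidable_less: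
  assumes "computable f" "computable g" shows "decidable (\<lambda>x. f x \<prec> g x)"
proof -
  let ?pair = "\<lambda>z i j. z \<oplus> z = (i \<oplus> j) \<otimes> (i \<oplus> j \<oplus> \<one>) \<oplus> (i \<oplus> i)"
  have "decidable (\<lambda>z. \<exists>i. i \<prec> z \<oplus> \<one> \<and> (\<exists>j. j \<prec> z \<oplus> \<one> \<and> ?pair z i j \<and> i \<prec> j))"
    by (intro decidableI_delta0 delta0_intros)
  also have "(\<lambda>z. \<exists>i. i \<prec> z \<oplus> \<one> \<and> (\<exists>j. j \<prec> z \<oplus> \<one> \<and> ?pair z i j \<and> i \<prec> j)) = (\<lambda>z. first z \<prec> second z)"
    unfolding pair_iff[symmetric] less_add_one_iff
    by (metis first_le second_le first_pair second_pair pair_first_second)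
  finally have *: "decidable (\<lambda>z. first z \<prec> second z)" .
  show ?thesis using decidable_compose[OF *, of "\<lambda>x. \<langle>f x, g x\<rangle>"] assms
    by (simp add: computable_pair)
qed

lemma decidable_leq: assumes "computable f" "computable g" shows "decidable (\<lambda>x. f x \<preceq> g x)"
  using decidable_not[OF decidable_less[OF assms(2,1)]] by (simp only: arith.not_less)

lemma decidable_eq: assumes "computable f" "computable g" shows "decidable (\<lambda>x. f x = g x)"
proof -
  have "decidable (\<lambda>x. f x \<preceq> g x \<and> g x \<preceq> f x)" by (intro decidable_conj decidable_leq assms)
  moreover have "f x \<preceq> g x \<and> g x \<preceq> f x \<longleftrightarrow> f x = g x" for x
    by (metis arith.order_antisym arith.order_refl)
  ultimately show ?thesis by simp
qed

text \<open>
  Binary predicates are coded by unary ones through pairing, with the two arguments read off by the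
  projections.  The bounded quantifier rules produce premises of the same form.
\<close>

definition decidable2 :: "('a \<Rightarrow> 'a \<Rightarrow> bool) \<Rightarrow> bool" where
  "decidable2 R \<longleftrightarrow> decidable (\<lambda>z. R (first z) (second z))"

lemma decidable2D:
  assumes R: "decidable2 R" and "computable f" "computable g"
  shows "decidable (\<lambda>x. R (f x) (g x))"
  using decidable_compose[OF R[unfolded decidable2_def] computable_pair[OF assms(2,3)]] by simp

text \<open>
  All pairs \<open>\<langle>x, y\<rangle>\<close> with \<open>y\<close> below the bound \<open>b\<close> are below \<open>\<langle>x, b\<rangle> + 1\<close>.  So a single number, the \<open>n\<close>
  of the \<open>\<Sigma>\<^sup>0\<^sub>1\<close> form, bounds the witnesses \<open>p\<close> for all \<open>y\<close> at once.
\<close>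

lemma decidable_all_less:
  assumes f: "computable f" and R: "decidable (\<lambda>z. R (first z) (second z))"
  shows "decidable (\<lambda>x. \<forall>y. y \<prec> f x \<longrightarrow> R x y)"
proof -
  let ?R = "{z. R (first z) (second z)}"
  let ?pair = "\<lambda>z i j. z \<oplus> z = (i \<oplus> j) \<otimes> (i \<oplus> j \<oplus> \<one>) \<oplus> (i \<oplus> i)"
  have R: "?R \<in> \<S>" using R by (simp add: decidable_def)
  let ?P = "\<lambda>n w a. \<exists>x. x \<prec> w \<oplus> \<one> \<and> (\<exists>b. b \<prec> w \<oplus> \<one> \<and> ?pair w x b \<and>
      (\<forall>y. y \<prec> b \<longrightarrow> (\<exists>p. p \<prec> n \<and> ?pair p x y \<and> p \<in> ?R)))"
  let ?Q = "\<lambda>n w a. \<forall>x. x \<prec> w \<oplus> \<one> \<longrightarrow> (\<forall>b. b \<prec> w \<oplus> \<one> \<longrightarrow> ?pair w x b \<longrightarrow>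
      (\<forall>y. y \<prec> b \<longrightarrow> ?pair n x y \<longrightarrow> n \<in> ?R))"
  have *: "decidable (\<lambda>w. \<forall>y. y \<prec> second w \<longrightarrow> R (first w) y)"
  proof (rule decidableI[where a=\<zero>])
    show "delta0 (\<lambda>e. ?P (e 0) (e 1) (e 2))" by (intro delta0_intros R)
    show "delta0 (\<lambda>e. ?Q (e 0) (e 1) (e 2))" by (intro delta0_intros R)
    fix w
    have "(\<exists>n. ?P n w \<zero>) \<longleftrightarrow> (\<exists>n. \<forall>y. y \<prec> second w \<longrightarrow> \<langle>first w, y\<rangle> \<prec> n \<and> R (first w) y)"
      unfolding pair_iff[symmetric] less_add_one_iff
      by (rule pair_surj[of w]) (auto simp: first_le second_le)
    also have "\<dots> \<longleftrightarrow> (\<forall>y. y \<prec> second w \<longrightarrow> R (first w) y)"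
    proof -
      \<comment> \<open>The code \<open>w\<close> itself serves as bound, by monotonicity of pairing.\<close>
      have "\<langle>first w, y\<rangle> \<prec> w \<oplus> \<one>" if "y \<prec> second w" for y
        using pair_mono[of y "second w" "first w"] that
        by (simp add: less_add_one_iff)
      then show ?thesis by blast
    qed
    finally show "(\<forall>y. y \<prec> second w \<longrightarrow> R (first w) y) \<longleftrightarrow> (\<exists>n. ?P n w \<zero>)" by simp
    show "(\<forall>y. y \<prec> second w \<longrightarrow> R (first w) y) \<longleftrightarrow> (\<forall>n. ?Q n w \<zero>)"
      unfolding pair_iff[symmetric] less_add_one_iff
      by (rule pair_surj[of w]) (auto simp: first_le second_le)
  qed
  show ?thesis using decidable_compose[OF *, of "\<lambda>x. \<langle>x, f x\<rangle>"] f
    by (simp add: computable_intros)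
qed

lemma decidable_ex_less:
  assumes "computable f" "decidable (\<lambda>z. R (first z) (second z))"
  shows "decidable (\<lambda>x. \<exists>y. y \<prec> f x \<and> R x y)"
proof -
  have "decidable (\<lambda>x. \<not> (\<forall>y. y \<prec> f x \<longrightarrow> \<not> R x y))"
    by (intro decidable_not decidable_all_less assms)
  then show ?thesis by simp
qed

lemmas decidable_intros = decidable_const decidable_ex_less decidable_all_less decidable_conj
  decidable_disj decidable_iff decidable_imp decidable_not decidable_less decidable_leq decidable_eq
  decidable_Mem

text \<open>
  Here and below, a \<open>\<Sigma>\<^sup>0\<^sub>1\<close> predicate is given as \<open>\<exists>n. R x n\<close> with a decidable \<open>R\<close>.
\<close>

lemma sigma1_induct:
  assumes R: "decidable2 R" and base: "\<exists>n. R \<zero> n" and step: "\<And>x n. R x n \<Longrightarrow> \<exists>n. R (x \<oplus> \<one>) n"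
  shows "\<exists>n. R x n"
proof -
  let ?R = "{z. R (first z) (second z)}"
  let ?pair = "\<lambda>z i j. z \<oplus> z = (i \<oplus> j) \<otimes> (i \<oplus> j \<oplus> \<one>) \<oplus> (i \<oplus> i)"
  have "?R \<in> \<S>" using R by (simp add: decidable2_def decidable_def)
  let ?P = "\<lambda>n x a b. n \<in> ?R \<and> (\<exists>y. y \<prec> n \<oplus> \<one> \<and> ?pair n x y)"
  have P: "(\<exists>n. ?P n x \<zero> \<zero>) \<longleftrightarrow> (\<exists>n. R x n)" for x
    unfolding pair_iff[symmetric] less_add_one_iff using second_le by force
  have "\<exists>n. ?P n x \<zero> \<zero>"
  proof (rule delta0_sigma1_induct[where P="?P"])
    show "delta0 (\<lambda>e. ?P (e 0) (e 1) (e 2) (e 3))" by (intro delta0_intros \<open>?R \<in> \<S>\<close>)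
    show "\<exists>n. ?P n \<zero> \<zero> \<zero>" using base P by blast
    show "\<exists>n. ?P n (x \<oplus> \<one>) \<zero> \<zero>" if "?P n x \<zero> \<zero>" for x n
      using that step P by blast
  qed
  then show ?thesis using P by blast
qed

lemma decidable_induct:
  assumes "decidable P" "P \<zero>" "\<And>x. P x \<Longrightarrow> P (x \<oplus> \<one>)"
  shows "P x"
proof -
  have "decidable2 (\<lambda>x n. P x)"
    unfolding decidable2_def by (intro decidable_compose[OF assms(1)] computable_first)
  then show ?thesis using sigma1_induct[of "\<lambda>x n. P x"] assms(2,3) by blast
qed

lemma decidable_less_induct:
  assumes P: "decidable P" and step: "\<And>x. (\<And>y. y \<prec> x \<Longrightarrow> P y) \<Longrightarrow> P x"
  shows "P x"
proof -
  have "\<forall>y. y \<prec> x \<longrightarrow> P y"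
  proof (rule decidable_induct[where x=x])
    show "decidable (\<lambda>x. \<forall>y. y \<prec> x \<longrightarrow> P y)"
      by (intro decidable_intros decidable_compose[OF P] computable_intros)
  qed (auto simp: not_less_zero less_add_one intro: step)
  then show ?thesis using step by blast
qed

lemma decidable_Least:
  assumes P: "decidable P" and x: "P x"
  shows "P (arith.Least P)" "\<And>y. P y \<Longrightarrow> arith.Least P \<preceq> y"
proof -
  have "\<exists>m. P m \<and> (\<forall>y. P y \<longrightarrow> m \<preceq> y)"
  proof (rule ccontr)
    assume no: "\<not> ?thesis"
    have "\<not> P y" for y
    proof (rule decidable_less_induct[of "\<lambda>y. \<not> P y"])
      show "decidable (\<lambda>y. \<not> P y)" by (intro decidable_intros P)
      show "\<not> P y" if "\<And>z. z \<prec> y \<Longrightarrow> \<not> P z" for y using that no arith.not_le by blast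
    qed
    with x show False by blast
  qed
  then obtain m where m: "P m" "\<And>y. P y \<Longrightarrow> m \<preceq> y" by blast
  then have "arith.Least P = m" by (rule arith.Least_equality)
  with m show "P (arith.Least P)" "\<And>y. P y \<Longrightarrow> arith.Least P \<preceq> y" by auto
qed

lemma computable_graphI:
  assumes "decidable2 (\<lambda>x y. y = f x)" shows "computable f"
proof -
  have "{z. second z = f (first z)} = graph f"
    unfolding graph_def by (auto, metis pair_first_second)
  then show ?thesis using assms by (simp add: decidable2_def decidable_def computable_def)
qed

lemma decidable2_section: "decidable2 R \<Longrightarrow> decidable (R x)"
  using decidable2D[of R "\<lambda>_. x" "\<lambda>y. y"] by (simp add: computable_intros)

lemma computable_Least:
  assumes R: "decidable2 R" and ex: "\<And>x. \<exists>y. R x y"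
  shows "computable (\<lambda>x. arith.Least (R x))"
proof (rule computable_graphI)
  have "(\<lambda>x y. y = arith.Least (R x)) = (\<lambda>x y. R x y \<and> (\<forall>z. z \<prec> y \<longrightarrow> \<not> R x z))"
    using decidable_Least[OF decidable2_section[OF R]] ex
    by (intro ext) (metis arith.order_antisym arith.not_le)
  moreover have "decidable2 \<dots>"
    unfolding decidable2_def by (intro decidable_intros decidable2D[OF R] computable_intros)
  ultimately show "decidable2 (\<lambda>x y. y = arith.Least (R x))" by simp
qed

text \<open>
  \<open>\<Delta>\<^sup>0\<^sub>1\<close> comprehension once more, for predicates that are decidable rather than bounded: search for
  the first \<open>y\<close> that settles the question in either direction.
\<close>

lemma decidable_ex:
  assumes R: "decidable2 R" and Q: "decidable2 Q" and iff: "\<And>x. (\<exists>y. R x y) \<longleftrightarrow> (\<forall>y. Q x y)"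
  shows "decidable (\<lambda>x. \<exists>y. R x y)"
proof -
  define f where "f x = arith.Least (\<lambda>y. R x y \<or> \<not> Q x y)" for x
  have dec: "decidable2 (\<lambda>x y. R x y \<or> \<not> Q x y)"
    unfolding decidable2_def by (intro decidable_intros decidable2D[OF R] decidable2D[OF Q] computable_intros)
  have f: "R x (f x) \<or> \<not> Q x (f x)" for x
    unfolding f_def using decidable_Least(1)[OF decidable2_section[OF dec]] iff by blast
  have "computable f" unfolding f_def using iff by (intro computable_Least dec) blast
  then have "decidable (\<lambda>x. R x (f x))" by (intro decidable2D[OF R] computable_id)
  also have "(\<lambda>x. R x (f x)) = (\<lambda>x. \<exists>y. R x y)" using f iff by blast
  finally show ?thesis .
qed

lemma computable_bounded:
  assumes f: "computable f" shows "\<exists>b. \<forall>x. x \<prec> n \<longrightarrow> f x \<prec> b"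
proof (rule sigma1_induct[where R="\<lambda>n b. \<forall>x. x \<prec> n \<longrightarrow> f x \<prec> b"])
  show "decidable2 (\<lambda>n b. \<forall>x. x \<prec> n \<longrightarrow> f x \<prec> b)" unfolding decidable2_def
    by (intro decidable_intros computable_intros computable_compose[OF f])
  show "\<exists>b'. \<forall>x. x \<prec> n \<oplus> \<one> \<longrightarrow> f x \<prec> b'" if "\<forall>x. x \<prec> n \<longrightarrow> f x \<prec> b" for n b
    using that exists_bound3[of b "f n" b] unfolding less_add_one by (metis arith.less_trans)
qed (simp add: not_less_zero)

text \<open>
  \<open>\<Sigma>\<^sup>0\<^sub>1\<close> bounding.  The least witness is a computable function of \<open>x\<close>, and computable functions are
  bounded on bounded sets.
\<close>

lemma bounded_choice:
  assumes R: "decidable2 R" and ex: "\<And>x. x \<prec> n \<Longrightarrow> \<exists>y. R x y"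
  shows "\<exists>b. \<forall>x. x \<prec> n \<longrightarrow> (\<exists>y. y \<prec> b \<and> R x y)"
proof -
  have dec: "decidable2 (\<lambda>x y. x \<prec> n \<longrightarrow> R x y)"
    unfolding decidable2_def by (intro decidable_intros decidable2D[OF R] computable_intros)
  let ?f = "\<lambda>x. arith.Least (\<lambda>y. x \<prec> n \<longrightarrow> R x y)"
  have "computable ?f" by (intro computable_Least dec) (use ex in blast)
  then obtain b where "\<forall>x. x \<prec> n \<longrightarrow> ?f x \<prec> b" using computable_bounded by blast
  moreover have "x \<prec> n \<longrightarrow> R x (?f x)" for x
    using decidable_Least(1)[OF decidable2_section[OF dec], of x] ex by blast
  ultimately show ?thesis by blast
qed

section \<open>Codes of finite sets\<close>

lemma divides_iff_dvd: "divides M a b \<longleftrightarrow> arith.dvd a b"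
  by (simp add: divides_def arith.dvd_def)

lemma le_mult_nonzero: "a \<noteq> \<zero> \<Longrightarrow> b \<preceq> a \<otimes> b"
proof -
  assume "a \<noteq> \<zero>"
  then have "\<one> \<preceq> a" using zero_or_add_one by force
  then have "\<one> \<otimes> b \<preceq> a \<otimes> b" by (intro arith.mult_right_mono) simp_all
  then show ?thesis by simp
qed

lemma dvd_le: "arith.dvd a b \<Longrightarrow> b \<noteq> \<zero> \<Longrightarrow> a \<preceq> b"
  using le_mult_nonzero by (metis arith.dvdE arith.mult.commute arith.mult_zero_right)

lemma decidable_dvd:
  assumes "computable f" "computable g"
  shows "decidable (\<lambda>x. arith.dvd (f x) (g x))"
proof -
  have "arith.dvd a b \<longleftrightarrow> (\<exists>q. q \<prec> b \<oplus> \<one> \<and> b = a \<otimes> q)" for a b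
  proof
    assume "arith.dvd a b"
    then obtain q where q: "b = a \<otimes> q" by (rule arith.dvdE)
    show "\<exists>q. q \<prec> b \<oplus> \<one> \<and> b = a \<otimes> q"
    proof (cases "a = \<zero>")
      case True
      then show ?thesis using q by (intro exI[of _ \<zero>]) (simp add: less_add_one_iff)
    next
      case False
      then show ?thesis using q le_mult_nonzero by (intro exI[of _ q]) (simp add: less_add_one_iff)
    qed
  qed (auto intro: arith.dvdI)
  moreover have "decidable (\<lambda>x. \<exists>q. q \<prec> g x \<oplus> \<one> \<and> g x = f x \<otimes> q)"
    by (intro decidable_intros computable_intros computable_compose[OF assms(1)]
        computable_compose[OF assms(2)] assms)
  ultimately show ?thesis by simp
qed

lemma common_multiple:
  assumes f: "computable f" and pos: "\<And>i. i \<prec> l \<Longrightarrow> f i \<noteq> \<zero>"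
  shows "\<exists>N. N \<noteq> \<zero> \<and> (\<forall>i. i \<prec> l \<longrightarrow> arith.dvd (f i) N)"
proof -
  have "\<exists>N. N \<noteq> \<zero> \<and> (\<forall>i. i \<prec> j \<longrightarrow> i \<prec> l \<longrightarrow> arith.dvd (f i) N)" for j
  proof (rule sigma1_induct[where R="\<lambda>j N. N \<noteq> \<zero> \<and> (\<forall>i. i \<prec> j \<longrightarrow> i \<prec> l \<longrightarrow> arith.dvd (f i) N)"])
    show "decidable2 (\<lambda>j N. N \<noteq> \<zero> \<and> (\<forall>i. i \<prec> j \<longrightarrow> i \<prec> l \<longrightarrow> arith.dvd (f i) N))"
      unfolding decidable2_def
      by (intro decidable_intros decidable_dvd computable_intros computable_compose[OF f])
    show "\<exists>N. N \<noteq> \<zero> \<and> (\<forall>i. i \<prec> \<zero> \<longrightarrow> i \<prec> l \<longrightarrow> arith.dvd (f i) N)"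
      by (auto simp: not_less_zero intro: exI[of _ \<one>])
    fix j N assume *: "N \<noteq> \<zero> \<and> (\<forall>i. i \<prec> j \<longrightarrow> i \<prec> l \<longrightarrow> arith.dvd (f i) N)"
    show "\<exists>N. N \<noteq> \<zero> \<and> (\<forall>i. i \<prec> j \<oplus> \<one> \<longrightarrow> i \<prec> l \<longrightarrow> arith.dvd (f i) N)"
    proof (cases "j \<prec> l")
      case True
      with * pos have "N \<otimes> f j \<noteq> \<zero> \<and> (\<forall>i. i \<prec> j \<oplus> \<one> \<longrightarrow> i \<prec> l \<longrightarrow> arith.dvd (f i) (N \<otimes> f j))"
        by (auto simp: less_add_one)
      then show ?thesis by blast
    next
      case False
      with * show ?thesis unfolding less_add_one by blast
    qed
  qed
  then show ?thesis by blast
qed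

text \<open>
  The moduli of Goedel's beta function.  If all positive numbers up to \<open>l\<close> divide \<open>m\<close>, then those with
  \<open>i < l\<close> are pairwise coprime, in the form of \<open>modulus_euclid\<close>: if the modulus of \<open>i\<close> divides \<open>n\<close>
  times that of \<open>j\<close>, then it divides \<open>n m (i - j)\<close>, hence \<open>n m\<^sup>2\<close>, hence \<open>n\<close>, being coprime to \<open>m\<close>.
\<close>

definition modulus :: "'a \<Rightarrow> 'a \<Rightarrow> 'a" where "modulus m i = m \<otimes> (i \<oplus> \<one>) \<oplus> \<one>"

lemma computable_modulus: "computable f \<Longrightarrow> computable g \<Longrightarrow> computable (\<lambda>x. modulus (f x) (g x))"
  unfolding modulus_def by (intro computable_intros)

lemma modulus_nonzero: "modulus m i \<noteq> \<zero>" by (simp only: modulus_def add_one_neq_zero not_False_eq_True)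

lemma modulus_coprime: assumes "arith.dvd (modulus m i) (x \<otimes> m)" shows "arith.dvd (modulus m i) x"
proof -
  have "arith.dvd (modulus m i) (x \<otimes> m \<otimes> (i \<oplus> \<one>) \<oplus> x)"
    using arith.dvd_triv_right[of "modulus m i" x] by (simp add: modulus_def distrib_left' arith.mult.assoc)
  then show ?thesis using arith.dvd_add_right_iff[OF arith.dvd_mult2[OF assms]] by simp
qed

lemma modulus_euclid:
  assumes m: "\<And>d. d \<prec> l \<Longrightarrow> arith.dvd (d \<oplus> \<one>) m" and ij: "i \<prec> l" "j \<prec> l" "i \<noteq> j"
    and dvd: "arith.dvd (modulus m i) (n \<otimes> modulus m j)"
  shows "arith.dvd (modulus m i) n"
proof -
  obtain d where d: "d \<prec> l" "arith.dvd (modulus m i) (n \<otimes> m \<otimes> (d \<oplus> \<one>))"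
  proof (cases "i \<prec> j")
    case True
    then obtain d where "j = i \<oplus> d \<oplus> \<one>" using less_iff_add_one by blast
    then have j: "j = i \<oplus> (d \<oplus> \<one>)" by (simp add: add_assoc')
    then have "d \<prec> l" using ij(2)
      by (metis arith.le_less_trans arith.less_trans less_add_one leq_iff_add arith.add.commute)
    moreover have "n \<otimes> modulus m j = n \<otimes> modulus m i \<oplus> n \<otimes> m \<otimes> (d \<oplus> \<one>)"
      by (simp add: j modulus_def expand_simps)
    then have "arith.dvd (modulus m i) (n \<otimes> m \<otimes> (d \<oplus> \<one>))"
      using dvd arith.dvd_add_right_iff[OF arith.dvd_triv_right[of "modulus m i" n]] by simp
    ultimately show ?thesis using that by blast
  next
    case False
    then obtain d where "i = j \<oplus> d \<oplus> \<one>" using less_iff_add_one ij(3) arith.neqE by metis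
    then have i: "i = j \<oplus> (d \<oplus> \<one>)" by (simp add: add_assoc')
    then have "d \<prec> l" using ij(1)
      by (metis arith.le_less_trans arith.less_trans less_add_one leq_iff_add arith.add.commute)
    moreover have "n \<otimes> modulus m i = n \<otimes> modulus m j \<oplus> n \<otimes> m \<otimes> (d \<oplus> \<one>)"
      by (simp add: i modulus_def expand_simps)
    then have "arith.dvd (modulus m i) (n \<otimes> m \<otimes> (d \<oplus> \<one>))"
      using arith.dvd_add_right_iff[OF dvd] arith.dvd_triv_right[of "modulus m i" n] by simp
    ultimately show ?thesis using that by blast
  qed
  obtain q where "m = (d \<oplus> \<one>) \<otimes> q" using m[OF d(1)] by (rule arith.dvdE)
  then have "n \<otimes> m \<otimes> m = n \<otimes> m \<otimes> (d \<oplus> \<one>) \<otimes> q" by (metis arith.mult.assoc)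
  then have "arith.dvd (modulus m i) (n \<otimes> m \<otimes> m)" using d(2) arith.dvd_mult2 by metis
  then show ?thesis using modulus_coprime by blast
qed

text \<open>
  A pair \<open>\<langle>m, N\<rangle>\<close> in terms of which all subsets of \<open>{0..<l}\<close> can be coded: they will be given by
  divisors of \<open>N\<close>.  The number \<open>N\<close> is what bounds the codes, uniformly in the subset.
\<close>

definition code_base :: "'a \<Rightarrow> 'a \<Rightarrow> bool" where
  "code_base l w \<longleftrightarrow> first w \<noteq> \<zero> \<and> second w \<noteq> \<zero> \<and> (\<forall>d. d \<prec> l \<longrightarrow> arith.dvd (d \<oplus> \<one>) (first w)) \<and>
     (\<forall>i. i \<prec> l \<longrightarrow> arith.dvd (modulus (first w) i) (second w))"

lemma code_base_exists: "\<exists>w. code_base l w"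
proof -
  obtain m where m: "m \<noteq> \<zero>" "\<forall>d. d \<prec> l \<longrightarrow> arith.dvd (d \<oplus> \<one>) m"
    using common_multiple[of "\<lambda>d. d \<oplus> \<one>" l] add_one_neq_zero computable_intros by blast
  obtain N where "N \<noteq> \<zero>" "\<forall>i. i \<prec> l \<longrightarrow> arith.dvd (modulus m i) N"
    using common_multiple[of "modulus m" l] modulus_nonzero computable_modulus[of "\<lambda>_. m" "\<lambda>x. x"]
      computable_const computable_id by blast
  with m show ?thesis unfolding code_base_def by (intro exI[of _ "\<langle>m, N\<rangle>"]) simp
qed

lemma decidable2_code_base: "decidable2 code_base"
  unfolding decidable2_def code_base_def
  by (intro decidable_intros decidable_dvd computable_modulus computable_intros)

text \<open>
  Codes grow with their last component, so the code built from \<open>N\<close> bounds all those built from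
  divisors of \<open>N\<close>.  The least pair is taken in order to make the bound computable.
\<close>

definition code_bound :: "'a \<Rightarrow> 'a" where
  "code_bound l = (let w = arith.Least (code_base l) in \<langle>\<langle>l, first w\<rangle>, second w\<rangle>)"

lemma computable_code_bound: "computable code_bound"
proof -
  have "computable (\<lambda>l. arith.Least (code_base l))"
    by (intro computable_Least decidable2_code_base code_base_exists)
  then show ?thesis unfolding code_bound_def Let_def by (intro computable_intros)
qed

lemma mem_elems_iff:
  "i \<in> elems M c \<longleftrightarrow> i \<prec> first (first c) \<and> arith.dvd (modulus (second (first c)) i) (second c)"
  by (simp add: elems_def divides_iff_dvd modulus_def)

lemma decidable_elems: "computable f \<Longrightarrow> computable g \<Longrightarrow> decidable (\<lambda>x. f x \<in> elems M (g x))"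
  unfolding mem_elems_iff by (intro decidable_intros decidable_dvd computable_modulus computable_intros)

lemma elems_less: "i \<in> elems M c \<Longrightarrow> i \<prec> c"
proof -
  assume "i \<in> elems M c"
  then have "i \<prec> first (first c)" by (simp add: mem_elems_iff)
  also have "\<dots> \<preceq> first c" using first_le[of "first (first c)" "second (first c)"] by simp
  also have "\<dots> \<preceq> c" using first_le[of "first c" "second c"] by simp
  finally show ?thesis .
qed

lemma elems_in_Sets: "elems M c \<in> \<S>"
  using decidable_elems[OF computable_id computable_const, of c] by (simp add: decidable_def)

text \<open>
  By induction on \<open>j\<close>, there is a divisor \<open>n\<close> of \<open>N\<close> that codes \<open>X \<inter> {0..<j}\<close>.  To multiply \<open>n\<close> by the
  modulus of \<open>j\<close> and remain a divisor of \<open>N\<close>, one needs that this modulus, which divides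
  \<open>N = n q\<close>, divides \<open>q\<close>.  Therefore the induction also claims that \<open>n\<close> is coprime to the moduli
  with index at least \<open>j\<close>.  Restricting the numbers \<open>z\<close> in this claim to \<open>z \<le> N\<close> keeps the predicate
  decidable.
\<close>

lemma elems_exist:
  assumes X: "X \<in> \<S>" "\<And>i. i \<in> X \<Longrightarrow> i \<prec> l"
  shows "\<exists>c. c \<preceq> code_bound l \<and> elems M c = X"
proof -
  define w where "w = arith.Least (code_base l)"
  obtain m N where w: "w = \<langle>m, N\<rangle>" by (rule pair_surj)
  have "code_base l w"
    unfolding w_def using decidable_Least(1)[OF decidable2_section[OF decidable2_code_base]] code_base_exists by blast
  then have m: "m \<noteq> \<zero>" "\<And>d. d \<prec> l \<Longrightarrow> arith.dvd (d \<oplus> \<one>) m"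
    and N: "N \<noteq> \<zero>" "\<And>i. i \<prec> l \<Longrightarrow> arith.dvd (modulus m i) N" by (simp_all add: code_base_def w)
  let ?P = "\<lambda>j. j \<preceq> l \<longrightarrow> (\<exists>n. n \<prec> N \<oplus> \<one> \<and> arith.dvd n N \<and>
      (\<forall>i. i \<prec> l \<longrightarrow> (arith.dvd (modulus m i) n \<longleftrightarrow> i \<in> X \<and> i \<prec> j)) \<and>
      (\<forall>i. i \<prec> l \<longrightarrow> j \<preceq> i \<longrightarrow> (\<forall>z. z \<prec> N \<oplus> \<one> \<longrightarrow> arith.dvd (modulus m i) (n \<otimes> z) \<longrightarrow>
         arith.dvd (modulus m i) z)))"
  have "?P l"
  proof (rule decidable_induct[where P="?P"])
    show "decidable ?P"
      by (intro decidable_intros decidable_dvd computable_modulus computable_intros X)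
    have "\<not> arith.dvd (modulus m i) \<one>" for i
    proof
      assume "arith.dvd (modulus m i) \<one>"
      then have "modulus m i \<preceq> \<one>" using dvd_le by simp
      then have "m \<otimes> (i \<oplus> \<one>) = \<zero>" unfolding modulus_def by (simp add: leq_def not_less_zero)
      then show False using m(1) add_one_neq_zero by simp
    qed
    moreover have "\<one> \<preceq> N" using le_mult_nonzero[OF N(1), of \<one>] by simp
    moreover from this have "\<zero> \<prec> N" using arith.less_le_trans[OF arith.zero_less_one] by blast
    ultimately show "?P \<zero>" by (intro impI exI[of _ \<one>]) (auto simp: not_less_zero less_add_one_iff)
  next
    fix j assume IH: "?P j"
    show "?P (j \<oplus> \<one>)"
    proof
      assume "j \<oplus> \<one> \<preceq> l"
      then have "j \<prec> l" by (simp add: arith.less_iff_succ_less_eq)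
      have "\<exists>n. n \<prec> N \<oplus> \<one> \<and> arith.dvd n N \<and>
        (\<forall>i. i \<prec> l \<longrightarrow> (arith.dvd (modulus m i) n \<longleftrightarrow> i \<in> X \<and> i \<prec> j)) \<and>
        (\<forall>i. i \<prec> l \<longrightarrow> j \<preceq> i \<longrightarrow> (\<forall>z. z \<prec> N \<oplus> \<one> \<longrightarrow> arith.dvd (modulus m i) (n \<otimes> z) \<longrightarrow>
         arith.dvd (modulus m i) z))"
        by (rule IH[THEN mp, OF arith.less_imp_le[OF \<open>j \<prec> l\<close>]])
      then obtain n where n: "n \<preceq> N" "arith.dvd n N"
        and n3: "\<forall>i. i \<prec> l \<longrightarrow> (arith.dvd (modulus m i) n \<longleftrightarrow> i \<in> X \<and> i \<prec> j)"
        and n4: "\<forall>i. i \<prec> l \<longrightarrow> j \<preceq> i \<longrightarrow> (\<forall>z. z \<preceq> N \<longrightarrow> arith.dvd (modulus m i) (n \<otimes> z) \<longrightarrow>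
           arith.dvd (modulus m i) z)"
        unfolding less_add_one_iff by (elim exE conjE) (rule that)
      note n = n n3[rule_format] and cop = n4[rule_format]
      show "\<exists>n. n \<prec> N \<oplus> \<one> \<and> arith.dvd n N \<and>
        (\<forall>i. i \<prec> l \<longrightarrow> (arith.dvd (modulus m i) n \<longleftrightarrow> i \<in> X \<and> i \<prec> j \<oplus> \<one>)) \<and>
        (\<forall>i. i \<prec> l \<longrightarrow> j \<oplus> \<one> \<preceq> i \<longrightarrow> (\<forall>z. z \<prec> N \<oplus> \<one> \<longrightarrow> arith.dvd (modulus m i) (n \<otimes> z) \<longrightarrow>
         arith.dvd (modulus m i) z))" (is "\<exists>n. ?Q n")
      proof (cases "j \<in> X")
        case False
        have "?Q n"
        proof (intro conjI allI impI)
          show "n \<prec> N \<oplus> \<one>" "arith.dvd n N" using n by (simp_all add: less_add_one_iff)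
          show "arith.dvd (modulus m i) n \<longleftrightarrow> i \<in> X \<and> i \<prec> j \<oplus> \<one>" if "i \<prec> l" for i
            using n(3)[OF that] False by (auto simp: less_add_one)
          show "arith.dvd (modulus m i) z"
            if "i \<prec> l" "j \<oplus> \<one> \<preceq> i" "z \<prec> N \<oplus> \<one>" "arith.dvd (modulus m i) (n \<otimes> z)" for i z
            using cop[of i z] that by (simp add: less_add_one_iff arith.less_imp_le flip: arith.less_iff_succ_less_eq)
        qed
        then show ?thesis by (rule exI[where P="\<lambda>n. ?Q n"])
      next
        case True
        obtain q where q: "N = n \<otimes> q" using n(2) by (rule arith.dvdE)
        then have "n \<noteq> \<zero>" using N(1) by auto
        then have "q \<preceq> N" using q le_mult_nonzero by simp
        then have "arith.dvd (modulus m j) q" using cop[of j q] N(2) q \<open>j \<prec> l\<close> by simp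
        then obtain r where "q = modulus m j \<otimes> r" by (rule arith.dvdE)
        then have "N = (n \<otimes> modulus m j) \<otimes> r" using q by (simp add: arith.mult.assoc)
        then have dvd: "arith.dvd (n \<otimes> modulus m j) N" by (rule arith.dvdI)
        have "?Q (n \<otimes> modulus m j)"
        proof (intro conjI allI impI)
          show "n \<otimes> modulus m j \<prec> N \<oplus> \<one>" using dvd_le[OF dvd N(1)] by (simp add: less_add_one_iff)
          show "arith.dvd (n \<otimes> modulus m j) N" by (rule dvd)
          show "arith.dvd (modulus m i) (n \<otimes> modulus m j) \<longleftrightarrow> i \<in> X \<and> i \<prec> j \<oplus> \<one>" if "i \<prec> l" for i
          proof (cases "i = j")
            case False
            then have "arith.dvd (modulus m i) (n \<otimes> modulus m j) \<longleftrightarrow> arith.dvd (modulus m i) n"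
              using modulus_euclid[OF m(2) \<open>i \<prec> l\<close> \<open>j \<prec> l\<close>] arith.dvd_mult2 by blast
            then show ?thesis using n(3)[OF that] False by (simp add: less_add_one)
          qed (use True in \<open>simp add: less_add_one\<close>)
          fix i z assume *: "i \<prec> l" "j \<oplus> \<one> \<preceq> i" "z \<prec> N \<oplus> \<one>" "arith.dvd (modulus m i) (n \<otimes> modulus m j \<otimes> z)"
          then have "j \<prec> i" by (simp add: arith.less_iff_succ_less_eq)
          have "arith.dvd (modulus m i) ((n \<otimes> z) \<otimes> modulus m j)" using *(4) by (simp add: ac_simps)
          then have "arith.dvd (modulus m i) (n \<otimes> z)"
            using modulus_euclid[OF m(2) \<open>i \<prec> l\<close> \<open>j \<prec> l\<close>] \<open>j \<prec> i\<close> by blast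
          then show "arith.dvd (modulus m i) z"
            using cop *(1,3) \<open>j \<prec> i\<close> by (simp add: less_add_one_iff arith.less_imp_le)
        qed
        then show ?thesis by (rule exI[where P="\<lambda>n. ?Q n"])
      qed
    qed
  qed
  then obtain n where n: "n \<preceq> N" "\<And>i. i \<prec> l \<Longrightarrow> arith.dvd (modulus m i) n \<longleftrightarrow> i \<in> X \<and> i \<prec> l"
    by (auto simp: less_add_one_iff)
  have "elems M \<langle>\<langle>l, m\<rangle>, n\<rangle> = X" using n(2) X(2) by (auto simp: mem_elems_iff)
  moreover have "code_bound l = \<langle>\<langle>l, m\<rangle>, N\<rangle>" by (simp add: code_bound_def Let_def w flip: w_def)
  ultimately show ?thesis using pair_mono[OF n(1)] by metis
qed

lemma set_code_exists:
  assumes X: "X \<in> \<S>" "\<And>i. i \<in> X \<Longrightarrow> i \<prec> l"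
  shows "\<exists>c. c \<preceq> code_bound l \<and> set_code M c \<and> elems M c = X"
proof -
  have "elems M c = X \<longleftrightarrow> (\<forall>i. i \<prec> c \<oplus> l \<longrightarrow> (i \<in> elems M c \<longleftrightarrow> i \<in> X))" for c
    using elems_less[of _ c] X(2) arith.add_increasing arith.add_increasing2
    by (metis arith.less_le_trans leq_iff_add add_commute' set_eqI)
  moreover have "decidable (\<lambda>c. \<forall>i. i \<prec> c \<oplus> l \<longrightarrow> (i \<in> elems M c \<longleftrightarrow> i \<in> X))"
    by (intro decidable_intros decidable_elems computable_intros X)
  ultimately have dec: "decidable (\<lambda>c. elems M c = X)" by simp
  obtain c where c: "c \<preceq> code_bound l" "elems M c = X" using elems_exist[OF X] by blast
  let ?c = "arith.Least (\<lambda>c. elems M c = X)"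
  note * = decidable_Least[OF dec, of c, OF c(2)]
  have "set_code M ?c" unfolding set_code_def *(1) using *(2) arith.not_le by blast
  then show ?thesis using *(1) *(2)[OF c(2)] c(1) arith.order_trans by blast
qed

lemma set_code_inject: "set_code M c \<Longrightarrow> set_code M d \<Longrightarrow> elems M c = elems M d \<Longrightarrow> c = d"
  unfolding set_code_def by (metis arith.neqE)

lemma decidable_set_code: assumes "computable f" shows "decidable (\<lambda>x. set_code M (f x))"
proof -
  have "elems M d \<noteq> elems M c \<longleftrightarrow> (\<exists>i. i \<prec> c \<oplus> d \<and> \<not> (i \<in> elems M d \<longleftrightarrow> i \<in> elems M c))" for c d
    using elems_less[of _ c] elems_less[of _ d]
    by (metis arith.less_le_trans leq_iff_add add_commute' set_eqI)
  then have "decidable (set_code M)" unfolding set_code_def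
    by (simp only:) (intro decidable_intros decidable_elems computable_intros)
  then show ?thesis using assms by (rule decidable_compose)
qed

section \<open>Strings and trees\<close>

abbreviation length_of where "length_of \<equiv> len M"

lemma computable_len: "computable f \<Longrightarrow> computable (\<lambda>x. length_of (f x))"
  unfolding len_def by (intro computable_intros)

lemma decidable_bit: "computable f \<Longrightarrow> computable g \<Longrightarrow> decidable (\<lambda>x. bit M (f x) (g x))"
  unfolding bit_def by (intro decidable_elems computable_intros)

lemma len_le: "length_of s \<preceq> s"
  unfolding len_def using first_le[of "first s" "second s"] by simp

lemma bits_in_Sets: "{i. bit M s i} \<in> \<S>"
  unfolding bit_def using elems_in_Sets by simp

lemma bit_less_len: "s \<in> strings M \<Longrightarrow> bit M s i \<Longrightarrow> i \<prec> length_of s"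
  by (simp add: strings_def bit_def)

lemma string_eqI:
  assumes "s \<in> strings M" "t \<in> strings M" "length_of s = length_of t"
    and "\<And>i. i \<prec> length_of s \<Longrightarrow> bit M s i \<longleftrightarrow> bit M t i"
  shows "s = t"
proof -
  have "elems M (second s) = elems M (second t)"
    using assms bit_less_len unfolding bit_def by (metis subsetI subset_antisym)
  then have "second s = second t" using assms(1,2) by (auto simp: strings_def intro: set_code_inject)
  then show ?thesis using assms(3) unfolding len_def by (metis pair_first_second)
qed

definition string_bound :: "'a \<Rightarrow> 'a" where "string_bound l = \<langle>l, code_bound l\<rangle>"

lemma computable_string_bound: "computable f \<Longrightarrow> computable (\<lambda>x. string_bound (f x))"
  unfolding string_bound_def by (intro computable_intros computable_compose[OF computable_code_bound])

lemma string_obtain: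
  assumes "X \<in> \<S>"
  obtains s where "s \<in> strings M" "s \<preceq> string_bound l" "length_of s = l"
    "\<And>i. bit M s i \<longleftrightarrow> i \<prec> l \<and> i \<in> X"
proof -
  have "{i. i \<prec> l \<and> i \<in> X} \<in> \<S>"
    using decidable_conj[OF decidable_less[OF computable_id computable_const] decidable_Mem[OF assms computable_id], of l]
    by (simp add: decidable_def)
  then obtain c where "c \<preceq> code_bound l" "set_code M c" "elems M c = {i. i \<prec> l \<and> i \<in> X}"
    using set_code_exists[of "{i. i \<prec> l \<and> i \<in> X}" l] by blast
  then show thesis
    by (intro that[of "\<langle>l, c\<rangle>"]) (simp_all add: string_bound_def len_def bit_def strings_def pair_mono)
qed

lemma string_le_bound: assumes "s \<in> strings M" shows "s \<preceq> string_bound (length_of s)"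
proof -
  obtain t where t: "t \<in> strings M" "t \<preceq> string_bound (length_of s)" "length_of t = length_of s"
    "\<And>i. bit M t i \<longleftrightarrow> i \<prec> length_of s \<and> i \<in> {i. bit M s i}"
    by (rule string_obtain[OF bits_in_Sets[of s], of "length_of s"]) (rule that)
  have "s = t" by (rule string_eqI[OF assms t(1) t(3)[symmetric]]) (simp add: t(4))
  then show ?thesis using t(2) by (simp only:)
qed

lemma decidable_strings: assumes "computable f" shows "decidable (\<lambda>x. f x \<in> strings M)"
proof -
  have "s \<in> strings M \<longleftrightarrow> set_code M (second s) \<and>
      (\<forall>i. i \<prec> s \<longrightarrow> bit M s i \<longrightarrow> i \<prec> length_of s)" for s
  proof -
    have "i \<prec> s" if "i \<in> elems M (second s)" for i
      using elems_less[OF that] second_le[of "second s" "first s"] by simp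
    then show ?thesis by (auto simp: strings_def bit_def)
  qed
  moreover have "decidable (\<lambda>s. set_code M (second s) \<and>
      (\<forall>i. i \<prec> s \<longrightarrow> bit M s i \<longrightarrow> i \<prec> length_of s))"
    by (intro decidable_intros decidable_set_code decidable_bit computable_len computable_intros)
  ultimately have "decidable (\<lambda>s. s \<in> strings M)" by simp
  then show ?thesis using assms by (rule decidable_compose)
qed

lemma restriction_exists:
  assumes "s \<in> strings M" "l \<preceq> length_of s"
  shows "\<exists>t. initial_segment M t s \<and> length_of t = l"
proof -
  obtain t where "t \<in> strings M" "length_of t = l"
    "\<And>i. bit M t i \<longleftrightarrow> i \<prec> l \<and> i \<in> {i. bit M s i}"
    by (rule string_obtain[OF bits_in_Sets[of s], of l]) (rule that)
  then show ?thesis using assms by (intro exI[of _ t]) (simp add: initial_segment_def)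
qed

text \<open>
  If all strings in the tree were shorter than \<open>l\<close>, their codes would be bounded, as the bound on
  the codes of strings of a given length is computable.
\<close>

lemma tree_has_all_lengths:
  assumes T: "binary_tree M T" "unbounded M T"
  shows "\<exists>s\<in>T. length_of s = l"
proof -
  have "\<exists>s\<in>T. l \<preceq> length_of s"
  proof (rule ccontr)
    assume "\<not> ?thesis"
    then have short: "length_of s \<prec> l" if "s \<in> T" for s using that arith.not_le by blast
    obtain b where b: "\<forall>x. x \<prec> l \<longrightarrow> string_bound x \<prec> b"
      using computable_bounded[OF computable_string_bound[OF computable_id]] by blast
    have "s \<prec> b" if "s \<in> T" for s
    proof -
      have "s \<preceq> string_bound (length_of s)" using T(1) that by (auto simp: binary_tree_def intro: string_le_bound)
      also have "\<dots> \<prec> b" using b short[OF that] by blast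
      finally show ?thesis .
    qed
    then show False using T(2) arith.not_le unfolding unbounded_def by blast
  qed
  then obtain s where s: "s \<in> T" "l \<preceq> length_of s" by blast
  then obtain t where "initial_segment M t s" "length_of t = l"
    using restriction_exists T(1) unfolding binary_tree_def by blast
  then show ?thesis using s T(1) unfolding binary_tree_def by blast
qed

lemma unboundedI_lengths: "(\<And>l. \<exists>s\<in>T. l \<preceq> length_of s) \<Longrightarrow> unbounded M T"
  unfolding unbounded_def using len_le arith.order_trans by meson

text \<open>
  The homogeneous strings form a subtree, and one colour \<open>c\<close> works for all lengths: if each of the two
  colours failed at some length, both would fail at any larger length.
\<close>

lemma homogeneous_treeD:
  assumes T: "binary_tree M T" and H: "homogeneous_tree M H T"
  shows "\<exists>c. \<forall>l. \<exists>s\<in>T. length_of s = l \<and> (\<forall>i\<in>H. i \<prec> l \<longrightarrow> bit M s i = c)"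
proof -
  let ?T = "{s\<in>T. homogeneous_string M H s}"
  have "binary_tree M ?T" using T unfolding binary_tree_def homogeneous_string_def initial_segment_def
    by (smt (verit, ccfv_threshold) arith.less_le_trans mem_Collect_eq subset_iff)
  then have *: "\<exists>s\<in>?T. length_of s = l" for l
    using tree_has_all_lengths H unfolding homogeneous_tree_def by blast
  show ?thesis
  proof (rule ccontr)
    let ?P = "\<lambda>c l. \<exists>s\<in>T. length_of s = l \<and> (\<forall>i\<in>H. i \<prec> l \<longrightarrow> bit M s i = c)"
    assume "\<not> ?thesis"
    then obtain k l where no: "\<not> ?P True k" "\<not> ?P False l" by blast
    have mono: "?P c l" if P: "?P c l'" and "l \<preceq> l'" for c l l'
    proof -
      obtain s where s: "s \<in> T" "length_of s = l'" "\<And>i. i \<in> H \<Longrightarrow> i \<prec> l' \<Longrightarrow> bit M s i = c" using P by blast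
      obtain t where "initial_segment M t s" "length_of t = l"
        using restriction_exists s T \<open>l \<preceq> l'\<close> unfolding binary_tree_def by blast
      then show ?thesis using s T \<open>l \<preceq> l'\<close> arith.less_le_trans
        unfolding binary_tree_def initial_segment_def by (metis (no_types, lifting))
    qed
    have "k \<preceq> k \<oplus> l" "l \<preceq> k \<oplus> l" by (simp_all)
    moreover obtain s where "s \<in> ?T" "length_of s = k \<oplus> l" using * by blast
    ultimately show False using no mono unfolding homogeneous_string_def
      by (smt (verit) mem_Collect_eq)
  qed
qed

section \<open>Recursion along formulas\<close>

lemma bounded_set_coded: assumes "X \<in> \<S>" "\<And>i. i \<in> X \<Longrightarrow> i \<prec> l"
  obtains c where "elems M c = X"
  using elems_exist[OF assms] by blast

text \<open>
  Course-of-values recursion with a parameter \<open>t\<close>, where membership of \<open>p\<close> depends only on the part of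
  the set below \<open>p\<close>.  Codes of finite approximations exist by induction and agree where they are
  defined.  So the set is both the union of the approximations and the class of all \<open>p\<close> that are in
  every sufficiently long one, hence decidable.
\<close>

lemma set_recursion:
  assumes dec: "decidable (\<lambda>z. G (first (first z)) (second (first z)) (elems M (second z)))"
    and local: "\<And>t p X Y. (\<And>q. q \<prec> p \<Longrightarrow> q \<in> X \<longleftrightarrow> q \<in> Y) \<Longrightarrow> G t p X \<longleftrightarrow> G t p Y"
  shows "\<exists>V\<in>\<S>. \<forall>t p. \<langle>t, p\<rangle> \<in> V \<longleftrightarrow> G t p {q. \<langle>t, q\<rangle> \<in> V}"
proof -
  have G: "decidable (\<lambda>x. G (f x) (g x) (elems M (h x)))"
    if "computable f" "computable g" "computable h" for f g h
    using decidable_compose[OF dec, of "\<lambda>x. \<langle>\<langle>f x, g x\<rangle>, h x\<rangle>"] that by (simp add: computable_pair)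
  define approx where "approx t c n \<longleftrightarrow> (\<forall>p. p \<prec> n \<longrightarrow> (p \<in> elems M c \<longleftrightarrow> G t p (elems M c)))" for t c n
  have dec_approx: "decidable (\<lambda>x. approx (f x) (g x) (h x))"
    if "computable f" "computable g" "computable h" for f g h
    unfolding approx_def
    by (intro decidable_intros G decidable_elems computable_intros that
        computable_compose[OF that(1)] computable_compose[OF that(2)] computable_compose[OF that(3)])
  have approx_exists: "\<exists>c. approx t c n" for t n
  proof (rule sigma1_induct[where R="\<lambda>n c. approx t c n"])
    show "decidable2 (\<lambda>n c. approx t c n)"
      unfolding decidable2_def by (intro dec_approx computable_intros)
    show "\<exists>c. approx t c \<zero>" by (simp add: approx_def not_less_zero)
    fix n c assume c: "approx t c n"
    define X where "X = {p. p \<prec> n \<and> p \<in> elems M c \<or> p = n \<and> G t n (elems M c)}"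
    have "decidable (\<lambda>p. p \<prec> n \<and> p \<in> elems M c \<or> p = n \<and> G t n (elems M c))"
      by (intro decidable_intros decidable_elems computable_intros)
    then have "X \<in> \<S>" by (simp add: X_def decidable_def)
    then obtain d where d: "elems M d = X"
      by (rule bounded_set_coded[of X "n \<oplus> \<one>"]) (auto simp: X_def less_add_one)
    have X: "q \<in> X \<longleftrightarrow> q \<in> elems M c" if "q \<prec> n" for q using that by (auto simp: X_def)
    have "p \<in> X \<longleftrightarrow> G t p X" if "p \<preceq> n" for p
    proof -
      have "G t p X \<longleftrightarrow> G t p (elems M c)" by (rule local) (use X that arith.less_le_trans in blast)
      then show ?thesis using c that X unfolding approx_def leq_def by (auto simp: X_def)
    qed
    then have "approx t d (n \<oplus> \<one>)" by (simp add: approx_def d less_add_one_iff)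
    then show "\<exists>c. approx t c (n \<oplus> \<one>)" by blast
  qed
  have unique: "p \<in> elems M c \<longleftrightarrow> p \<in> elems M d" if "approx t c n" "approx t d m" "p \<prec> n" "p \<prec> m" for t c d n m p
  proof -
    have "p \<prec> n \<longrightarrow> p \<prec> m \<longrightarrow> (p \<in> elems M c \<longleftrightarrow> p \<in> elems M d)"
    proof (rule decidable_less_induct[where x=p])
      show "decidable (\<lambda>p. p \<prec> n \<longrightarrow> p \<prec> m \<longrightarrow> (p \<in> elems M c \<longleftrightarrow> p \<in> elems M d))"
        by (intro decidable_intros decidable_elems computable_intros)
      fix p assume IH: "\<And>q. q \<prec> p \<Longrightarrow> q \<prec> n \<longrightarrow> q \<prec> m \<longrightarrow> (q \<in> elems M c \<longleftrightarrow> q \<in> elems M d)"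
      show "p \<prec> n \<longrightarrow> p \<prec> m \<longrightarrow> (p \<in> elems M c \<longleftrightarrow> p \<in> elems M d)"
      proof (intro impI)
        assume p: "p \<prec> n" "p \<prec> m"
        then have "G t p (elems M c) \<longleftrightarrow> G t p (elems M d)"
          using IH arith.less_trans by (intro local) blast
        then show "p \<in> elems M c \<longleftrightarrow> p \<in> elems M d"
          using that(1,2) p unfolding approx_def by blast
      qed
    qed
    then show ?thesis using that by blast
  qed
  define V where "V = {z. \<exists>c. approx (first z) c (second z \<oplus> \<one>) \<and> second z \<in> elems M c}"
  have V: "\<langle>t, p\<rangle> \<in> V \<longleftrightarrow> p \<in> elems M c" if "approx t c n" "p \<prec> n" for t p c n
  proof
    assume "\<langle>t, p\<rangle> \<in> V"
    then obtain d where "approx t d (p \<oplus> \<one>)" "p \<in> elems M d" by (auto simp: V_def)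
    then show "p \<in> elems M c" using unique[OF that(1), of d "p \<oplus> \<one>" p] that(2) by (simp add: less_add_one)
  next
    assume "p \<in> elems M c"
    moreover have "approx t c (p \<oplus> \<one>)"
      using that unfolding approx_def less_add_one_iff by (meson arith.le_less_trans)
    ultimately show "\<langle>t, p\<rangle> \<in> V" by (auto simp: V_def)
  qed
  have "decidable (\<lambda>z. \<exists>c. approx (first z) c (second z \<oplus> \<one>) \<and> second z \<in> elems M c)"
  proof (rule decidable_ex)
    show "decidable2 (\<lambda>z c. approx (first z) c (second z \<oplus> \<one>) \<and> second z \<in> elems M c)"
      unfolding decidable2_def by (intro decidable_intros dec_approx decidable_elems computable_intros)
    show "decidable2 (\<lambda>z c. approx (first z) c (second z \<oplus> \<one>) \<longrightarrow> second z \<in> elems M c)"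
      unfolding decidable2_def by (intro decidable_intros dec_approx decidable_elems computable_intros)
    fix z
    obtain d where d: "approx (first z) d (second z \<oplus> \<one>)" using approx_exists by blast
    have "second z \<in> elems M c \<longleftrightarrow> second z \<in> elems M d" if "approx (first z) c (second z \<oplus> \<one>)" for c
      by (rule unique[OF that d]) (simp_all add: less_add_one)
    then show "(\<exists>c. approx (first z) c (second z \<oplus> \<one>) \<and> second z \<in> elems M c) \<longleftrightarrow>
        (\<forall>c. approx (first z) c (second z \<oplus> \<one>) \<longrightarrow> second z \<in> elems M c)"
      using d by blast
  qed
  then have "V \<in> \<S>" by (simp add: V_def decidable_def)
  moreover have "\<langle>t, p\<rangle> \<in> V \<longleftrightarrow> G t p {q. \<langle>t, q\<rangle> \<in> V}" for t p
  proof -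
    obtain c where c: "approx t c (p \<oplus> \<one>)" using approx_exists by blast
    have "\<langle>t, p\<rangle> \<in> V \<longleftrightarrow> p \<in> elems M c" using V[OF c] by (simp add: less_add_one)
    also have "\<dots> \<longleftrightarrow> G t p (elems M c)" using c by (simp add: approx_def less_add_one)
    also have "\<dots> \<longleftrightarrow> G t p {q. \<langle>t, q\<rangle> \<in> V}"
      by (rule local) (simp add: V[OF c] less_add_one)
    finally show ?thesis .
  qed
  ultimately show ?thesis by blast
qed

text \<open>
  The syntactic forms are told apart by the last digit of the code in base five.
\<close>

abbreviation five where "five \<equiv> \<one> \<oplus> \<one> \<oplus> \<one> \<oplus> \<one> \<oplus> \<one>"

lemma five_times_add_one: "five_times M (x \<oplus> \<one>) = five_times M x \<oplus> five"
  by (simp add: five_times_def ac_simps)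

lemma five_times_mono: "x \<preceq> y \<Longrightarrow> five_times M x \<preceq> five_times M y"
  unfolding five_times_def by (intro arith.add_mono)

lemma five_times_digit_inject:
  assumes "five_times M x \<oplus> r = five_times M y \<oplus> s" "r \<prec> five" "s \<prec> five"
  shows "x = y \<and> r = s"
proof -
  have less: "five_times M x \<oplus> r \<prec> five_times M y \<oplus> s" if "x \<prec> y" "r \<prec> five" for x y r s
  proof -
    have "five_times M x \<oplus> r \<prec> five_times M x \<oplus> five" using that(2) by (rule arith.add_strict_left_mono)
    also have "\<dots> \<preceq> five_times M y"
      using that(1) unfolding five_times_add_one[symmetric] arith.less_iff_succ_less_eq by (rule five_times_mono)
    also have "\<dots> \<preceq> five_times M y \<oplus> s" by simp
    finally show ?thesis .
  qed
  then have "x = y" using assms arith.neqE arith.less_irrefl by metis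
  then show ?thesis using assms(1) by simp
qed

lemma five_times_digit_eq_iff:
  "r \<prec> five \<Longrightarrow> s \<prec> five \<Longrightarrow> five_times M x \<oplus> r = five_times M y \<oplus> s \<longleftrightarrow> x = y \<and> r = s"
  using five_times_digit_inject by blast

lemma formula_digits:
  "AtomF M a = five_times M a \<oplus> \<zero>"
  "NotF M p = five_times M p \<oplus> \<one>"
  "AndF M p q = five_times M \<langle>p, q\<rangle> \<oplus> (\<one> \<oplus> \<one>)"
  "OrF M p q = five_times M \<langle>p, q\<rangle> \<oplus> (\<one> \<oplus> \<one> \<oplus> \<one>)"
  "ImpF M p q = five_times M \<langle>p, q\<rangle> \<oplus> (\<one> \<oplus> \<one> \<oplus> \<one> \<oplus> \<one>)"
  by (simp_all add: AtomF_def NotF_def AndF_def OrF_def ImpF_def ac_simps)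

lemma digits_less_five:
  "\<zero> \<prec> five" "\<one> \<prec> five" "\<one> \<oplus> \<one> \<prec> five" "\<one> \<oplus> \<one> \<oplus> \<one> \<prec> five" "\<one> \<oplus> \<one> \<oplus> \<one> \<oplus> \<one> \<prec> five"
  by (simp_all add: less_add_one)

lemma digits_distinct:
  "\<one> \<noteq> \<zero>" "\<one> \<oplus> \<one> \<noteq> \<zero>" "\<one> \<oplus> \<one> \<oplus> \<one> \<noteq> \<zero>" "\<one> \<oplus> \<one> \<oplus> \<one> \<oplus> \<one> \<noteq> \<zero>"
  "\<one> \<oplus> \<one> \<noteq> \<one>" "\<one> \<oplus> \<one> \<oplus> \<one> \<noteq> \<one>" "\<one> \<oplus> \<one> \<oplus> \<one> \<oplus> \<one> \<noteq> \<one>"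
  "\<one> \<oplus> \<one> \<oplus> \<one> \<noteq> \<one> \<oplus> \<one>" "\<one> \<oplus> \<one> \<oplus> \<one> \<oplus> \<one> \<noteq> \<one> \<oplus> \<one>"
  "\<one> \<oplus> \<one> \<oplus> \<one> \<oplus> \<one> \<noteq> \<one> \<oplus> \<one> \<oplus> \<one>"
  by (simp_all add: add_one_neq_zero)

lemma formula_inject [simp]:
  "AtomF M a = AtomF M b \<longleftrightarrow> a = b"
  "NotF M p = NotF M q \<longleftrightarrow> p = q"
  "AndF M p q = AndF M p' q' \<longleftrightarrow> p = p' \<and> q = q'"
  "OrF M p q = OrF M p' q' \<longleftrightarrow> p = p' \<and> q = q'"
  "ImpF M p q = ImpF M p' q' \<longleftrightarrow> p = p' \<and> q = q'"
  unfolding formula_digits by (simp_all only: five_times_digit_eq_iff digits_less_five pair_inject simp_thms)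

lemma formula_distinct [simp]:
  "AtomF M a \<noteq> NotF M q" "AtomF M a \<noteq> AndF M q r" "AtomF M a \<noteq> OrF M q r" "AtomF M a \<noteq> ImpF M q r"
  "NotF M p \<noteq> AndF M q r" "NotF M p \<noteq> OrF M q r" "NotF M p \<noteq> ImpF M q r"
  "AndF M p p' \<noteq> OrF M q r" "AndF M p p' \<noteq> ImpF M q r" "OrF M p p' \<noteq> ImpF M q r"
  unfolding formula_digits
  by (simp_all only: five_times_digit_eq_iff digits_less_five digits_distinct digits_distinct[symmetric] simp_thms)

lemmas formula_distinct' [simp] = formula_distinct[symmetric]

lemma le_five_times: "x \<preceq> five_times M x"
  unfolding five_times_def by (simp add: arith.add.assoc)

lemma subformula_less:
  "a \<preceq> AtomF M a" "p \<prec> NotF M p" "p \<prec> AndF M p q" "q \<prec> AndF M p q" "p \<prec> OrF M p q" "q \<prec> OrF M p q"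
  "p \<prec> ImpF M p q" "q \<prec> ImpF M p q"
proof -
  have *: "x \<prec> five_times M y \<oplus> \<one>" if "x \<preceq> y" for x y
    using that le_five_times arith.order_trans unfolding less_add_one_iff by blast
  then have "x \<prec> five_times M y \<oplus> \<one> \<oplus> \<one>" if "x \<preceq> y" for x y
    using that unfolding less_add_one by blast
  note ** = * this
  show "a \<preceq> AtomF M a" by (simp add: AtomF_def le_five_times)
  show "p \<prec> NotF M p" by (simp add: NotF_def *)
  show "p \<prec> AndF M p q" "q \<prec> AndF M p q" "p \<prec> OrF M p q" "q \<prec> OrF M p q"
    "p \<prec> ImpF M p q" "q \<prec> ImpF M p q"
    unfolding AndF_def OrF_def ImpF_def using **[OF first_le, of p q] **[OF second_le, of q p]
    by (simp_all only: less_add_one simp_thms)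
qed

lemma formula_cases:
  obtains (Atom) a where "p = AtomF M a" | (Not) q where "p = NotF M q"
  | (And) q r where "p = AndF M q r" | (Or) q r where "p = OrF M q r" | (Imp) q r where "p = ImpF M q r"
proof -
  let ?P = "\<lambda>p x. p = five_times M x \<or> p = five_times M x \<oplus> \<one> \<or> p = five_times M x \<oplus> \<one> \<oplus> \<one> \<or>
      p = five_times M x \<oplus> \<one> \<oplus> \<one> \<oplus> \<one> \<or> p = five_times M x \<oplus> \<one> \<oplus> \<one> \<oplus> \<one> \<oplus> \<one>"
  have "\<exists>x. ?P p x"
  proof (rule sigma1_induct[where R="?P"])
    show "decidable2 ?P" unfolding decidable2_def five_times_def
      by (intro decidable_intros computable_intros)
    show "\<exists>x. ?P \<zero> x" by (rule exI[of _ \<zero>]) (simp add: five_times_def)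
    show "\<exists>y. ?P (p \<oplus> \<one>) y" if "?P p x" for p x
    proof -
      have "?P (p \<oplus> \<one>) x \<or> p \<oplus> \<one> = five_times M (x \<oplus> \<one>)"
        using that unfolding five_times_add_one arith.add.assoc[symmetric] by blast
      then show ?thesis by blast
    qed
  qed
  then obtain x where x: "?P p x" by blast
  obtain q r where "x = \<langle>q, r\<rangle>" by (rule pair_surj)
  then show thesis using x Atom Not And Or Imp
    unfolding AtomF_def NotF_def AndF_def OrF_def ImpF_def by metis
qed

lemma computable_formulas:
  "computable f \<Longrightarrow> computable (\<lambda>x. AtomF M (f x))"
  "computable f \<Longrightarrow> computable (\<lambda>x. NotF M (f x))"
  "computable f \<Longrightarrow> computable g \<Longrightarrow> computable (\<lambda>x. AndF M (f x) (g x))"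
  "computable f \<Longrightarrow> computable g \<Longrightarrow> computable (\<lambda>x. OrF M (f x) (g x))"
  "computable f \<Longrightarrow> computable g \<Longrightarrow> computable (\<lambda>x. ImpF M (f x) (g x))"
  unfolding AtomF_def NotF_def AndF_def OrF_def ImpF_def five_times_def
  by (intro computable_intros; assumption)+


text \<open>
  Evaluation and occurrence of an atom obey recursion equations of the same kind, which differ in the
  Boolean operations only.
\<close>

definition clauses :: "('a \<Rightarrow> bool) \<Rightarrow> (bool \<Rightarrow> bool) \<Rightarrow> (bool \<Rightarrow> bool \<Rightarrow> bool) \<Rightarrow> (bool \<Rightarrow> bool \<Rightarrow> bool) \<Rightarrow>
    (bool \<Rightarrow> bool \<Rightarrow> bool) \<Rightarrow> 'a set \<Rightarrow> bool" where
  "clauses A n a i j V \<longleftrightarrow>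
     (\<forall>x. AtomF M x \<in> V \<longleftrightarrow> A x) \<and> (\<forall>p. NotF M p \<in> V \<longleftrightarrow> n (p \<in> V)) \<and>
     (\<forall>p q. AndF M p q \<in> V \<longleftrightarrow> a (p \<in> V) (q \<in> V)) \<and>
     (\<forall>p q. OrF M p q \<in> V \<longleftrightarrow> i (p \<in> V) (q \<in> V)) \<and>
     (\<forall>p q. ImpF M p q \<in> V \<longleftrightarrow> j (p \<in> V) (q \<in> V))"

lemma clauses_solution:
  assumes A: "decidable2 A"
  shows "\<exists>V\<in>\<S>. \<forall>t. clauses (A t) n a i j {p. \<langle>t, p\<rangle> \<in> V}"
proof -
  define G where "G t p X \<longleftrightarrow>
     (\<exists>x. x \<prec> p \<oplus> \<one> \<and> p = AtomF M x \<and> A t x) \<or>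
     (\<exists>q. q \<prec> p \<and> p = NotF M q \<and> n (q \<in> X)) \<or>
     (\<exists>q. q \<prec> p \<and> (\<exists>r. r \<prec> p \<and> (p = AndF M q r \<and> a (q \<in> X) (r \<in> X) \<or>
        p = OrF M q r \<and> i (q \<in> X) (r \<in> X) \<or> p = ImpF M q r \<and> j (q \<in> X) (r \<in> X))))" for t p X
  have decn: "decidable (\<lambda>x. u (P x))" if "decidable P" for u P
  proof (cases "u True"; cases "u False")
    assume "u True" "\<not> u False"
    then have "(\<lambda>x. u (P x)) = P" by (intro ext) (metis (full_types))
    then show ?thesis using that by simp
  next
    assume "\<not> u True" "u False"
    then have "(\<lambda>x. u (P x)) = (\<lambda>x. \<not> P x)" by (intro ext) (metis (full_types))
    then show ?thesis using decidable_not[OF that] by simp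
  next
    assume "u True" "u False"
    then have "(\<lambda>x. u (P x)) = (\<lambda>x. True)" by (intro ext) (metis (full_types))
    then show ?thesis by (simp add: decidable_const)
  next
    assume "\<not> u True" "\<not> u False"
    then have "(\<lambda>x. u (P x)) = (\<lambda>x. False)" by (intro ext) (metis (full_types))
    then show ?thesis by (simp add: decidable_const)
  qed
  have deca: "decidable (\<lambda>x. v (P x) (Q x))" if "decidable P" "decidable Q" for v P Q
  proof -
    have "(\<lambda>x. v (P x) (Q x)) = (\<lambda>x. (P x \<and> v True (Q x)) \<or> (\<not> P x \<and> v False (Q x)))"
      by (intro ext) (metis (full_types))
    moreover have "decidable \<dots>" by (intro decidable_disj decidable_conj decidable_not that decn[OF that(2)])
    ultimately show ?thesis by simp
  qed
  have "\<exists>V\<in>\<S>. \<forall>t p. \<langle>t, p\<rangle> \<in> V \<longleftrightarrow> G t p {q. \<langle>t, q\<rangle> \<in> V}"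
  proof (rule set_recursion)
    show "decidable (\<lambda>z. G (first (first z)) (second (first z)) (elems M (second z)))"
      unfolding G_def
      by (intro decidable_ex_less decidable_disj decidable_conj decidable_eq decidable2D[OF A] decn[of _ n]
          deca[of _ _ a] deca[of _ _ i] deca[of _ _ j]
          decidable_less decidable_elems computable_formulas computable_intros)
    show "G t p X \<longleftrightarrow> G t p Y" if "\<And>q. q \<prec> p \<Longrightarrow> q \<in> X \<longleftrightarrow> q \<in> Y" for t p X Y
      unfolding G_def by (simp add: that cong: conj_cong)
  qed
  then obtain V where V: "V \<in> \<S>" "\<And>t p. \<langle>t, p\<rangle> \<in> V \<longleftrightarrow> G t p {q. \<langle>t, q\<rangle> \<in> V}" by blast
  have "clauses (A t) n a i j {p. \<langle>t, p\<rangle> \<in> V}" for t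
  proof -
    have "AtomF M x \<in> {p. \<langle>t, p\<rangle> \<in> V} \<longleftrightarrow> A t x" for x
      using V(2)[of t "AtomF M x"] by (auto simp: G_def less_add_one_iff subformula_less)
    moreover have "NotF M p \<in> {p. \<langle>t, p\<rangle> \<in> V} \<longleftrightarrow> n (p \<in> {p. \<langle>t, p\<rangle> \<in> V})" for p
      using V(2)[of t "NotF M p"] by (auto simp: G_def subformula_less)
    moreover have "AndF M p q \<in> {p. \<langle>t, p\<rangle> \<in> V} \<longleftrightarrow> a (p \<in> {p. \<langle>t, p\<rangle> \<in> V}) (q \<in> {p. \<langle>t, p\<rangle> \<in> V})" for p q
      using V(2)[of t "AndF M p q"] by (auto simp: G_def subformula_less)
    moreover have "OrF M p q \<in> {p. \<langle>t, p\<rangle> \<in> V} \<longleftrightarrow> i (p \<in> {p. \<langle>t, p\<rangle> \<in> V}) (q \<in> {p. \<langle>t, p\<rangle> \<in> V})" for p q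
      using V(2)[of t "OrF M p q"] by (auto simp: G_def subformula_less)
    moreover have "ImpF M p q \<in> {p. \<langle>t, p\<rangle> \<in> V} \<longleftrightarrow> j (p \<in> {p. \<langle>t, p\<rangle> \<in> V}) (q \<in> {p. \<langle>t, p\<rangle> \<in> V})" for p q
      using V(2)[of t "ImpF M p q"] by (auto simp: G_def subformula_less)
    ultimately show ?thesis unfolding clauses_def by blast
  qed
  with V(1) show ?thesis by blast
qed

lemma evaluation_clauses: "evaluation M \<nu> V \<longleftrightarrow> clauses (\<lambda>x. x \<in> \<nu>) Not (\<and>) (\<or>) (\<longrightarrow>) V"
  unfolding evaluation_def clauses_def ..

lemma occurrence_clauses: "occurrence_set M a V \<longleftrightarrow> clauses (\<lambda>x. x = a) (\<lambda>p. p) (\<or>) (\<or>) (\<or>) V"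
  unfolding occurrence_set_def clauses_def ..

lemma section_in_Sets: "V \<in> \<S> \<Longrightarrow> {p. \<langle>t, p\<rangle> \<in> V} \<in> \<S>"
  using decidable_Mem[OF _ computable_pair[OF computable_const computable_id]] by (simp add: decidable_def)

text \<open>
  The uniform version, for a family of assignments, is what makes truth under strings decidable.
\<close>

lemma evaluations_exist:
  assumes "decidable2 A"
  shows "\<exists>V\<in>\<S>. \<forall>t. evaluation M {a. A t a} {p. \<langle>t, p\<rangle> \<in> V}"
  using clauses_solution[OF assms] unfolding evaluation_clauses by simp

lemma evaluation_exists: assumes "\<nu> \<in> \<S>" shows "\<exists>V\<in>\<S>. evaluation M \<nu> V"
proof -
  have "decidable2 (\<lambda>t a. a \<in> \<nu>)" unfolding decidable2_def by (intro decidable_Mem assms computable_intros)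
  then show ?thesis using evaluations_exist section_in_Sets by force
qed

lemma occurrence_set_exists: "\<exists>Z\<in>\<S>. occurrence_set M a Z"
proof -
  have "decidable2 (\<lambda>t x. x = a)" unfolding decidable2_def by (intro decidable_intros computable_intros)
  from clauses_solution[OF this] show ?thesis
    unfolding occurrence_clauses using section_in_Sets by blast
qed

text \<open>
  An atom is not larger than the formula in which it occurs, so the value of a formula below \<open>n\<close> depends
  on the atoms below \<open>n\<close> only.  This replaces any reference to the atoms that really occur.
\<close>

lemma evaluation_agree:
  assumes V: "evaluation M \<nu> V" "V \<in> \<S>" and W: "evaluation M \<mu> W" "W \<in> \<S>"
    and agree: "\<And>a. a \<prec> n \<Longrightarrow> a \<in> \<nu> \<longleftrightarrow> a \<in> \<mu>" and "p \<prec> n"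
  shows "p \<in> V \<longleftrightarrow> p \<in> W"
proof -
  have "p \<prec> n \<longrightarrow> (p \<in> V \<longleftrightarrow> p \<in> W)"
  proof (rule decidable_less_induct[where x=p])
    show "decidable (\<lambda>p. p \<prec> n \<longrightarrow> (p \<in> V \<longleftrightarrow> p \<in> W))"
      by (intro decidable_intros computable_intros V W)
    fix p assume IH: "\<And>q. q \<prec> p \<Longrightarrow> q \<prec> n \<longrightarrow> (q \<in> V \<longleftrightarrow> q \<in> W)"
    show "p \<prec> n \<longrightarrow> (p \<in> V \<longleftrightarrow> p \<in> W)"
    proof
      assume p: "p \<prec> n"
      then have IH: "q \<in> V \<longleftrightarrow> q \<in> W" if "q \<prec> p" for q using IH[OF that] that arith.less_trans by blast
      show "p \<in> V \<longleftrightarrow> p \<in> W"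
      proof (cases p rule: formula_cases)
        case (Atom a)
        then have "a \<prec> n" using p subformula_less(1) arith.le_less_trans by blast
        then show ?thesis using Atom V(1) W(1) agree unfolding evaluation_def by simp
      next
        case (Not q)
        then have "q \<in> V \<longleftrightarrow> q \<in> W" using IH subformula_less by simp
        then show ?thesis using Not V(1) W(1) unfolding evaluation_def by simp
      next
        case (And q r)
        then have "q \<in> V \<longleftrightarrow> q \<in> W" "r \<in> V \<longleftrightarrow> r \<in> W" using IH subformula_less by simp_all
        then show ?thesis using And V(1) W(1) unfolding evaluation_def by simp
      next
        case (Or q r)
        then have "q \<in> V \<longleftrightarrow> q \<in> W" "r \<in> V \<longleftrightarrow> r \<in> W" using IH subformula_less by simp_all
        then show ?thesis using Or V(1) W(1) unfolding evaluation_def by simp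
      next
        case (Imp q r)
        then have "q \<in> V \<longleftrightarrow> q \<in> W" "r \<in> V \<longleftrightarrow> r \<in> W" using IH subformula_less by simp_all
        then show ?thesis using Imp V(1) W(1) unfolding evaluation_def by simp
      qed
    qed
  qed
  with \<open>p \<prec> n\<close> show ?thesis by blast
qed

definition true_under :: "'a set \<Rightarrow> 'a \<Rightarrow> bool" where
  "true_under \<nu> p \<longleftrightarrow> (\<exists>V\<in>\<S>. evaluation M \<nu> V \<and> p \<in> V)"

lemma satisfies_iff: "satisfies M \<nu> C \<longleftrightarrow> (\<forall>p\<in>C. true_under \<nu> p)"
  by (simp add: satisfies_def true_under_def)

lemma true_under_iff: "evaluation M \<nu> V \<Longrightarrow> V \<in> \<S> \<Longrightarrow> true_under \<nu> p \<longleftrightarrow> p \<in> V"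
proof -
  assume V: "evaluation M \<nu> V" "V \<in> \<S>"
  have "p \<in> W \<longleftrightarrow> p \<in> V" if "evaluation M \<nu> W" "W \<in> \<S>" for W
    by (rule evaluation_agree[OF that V, where n="p \<oplus> \<one>"]) (simp_all add: less_add_one)
  then show ?thesis unfolding true_under_def using V by blast
qed

lemma true_under_agree:
  assumes "\<nu> \<in> \<S>" "\<mu> \<in> \<S>" "\<And>a. a \<prec> n \<Longrightarrow> a \<in> \<nu> \<longleftrightarrow> a \<in> \<mu>" "p \<prec> n"
  shows "true_under \<nu> p \<longleftrightarrow> true_under \<mu> p"
proof -
  obtain V W where "V \<in> \<S>" "evaluation M \<nu> V" "W \<in> \<S>" "evaluation M \<mu> W"
    using evaluation_exists assms(1,2) by blast
  then show ?thesis using evaluation_agree[of \<nu> V \<mu> W n p] assms(3,4) by (simp add: true_under_iff)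
qed

lemma true_under_simps:
  assumes "\<nu> \<in> \<S>"
  shows "true_under \<nu> (AtomF M a) \<longleftrightarrow> a \<in> \<nu>"
    "true_under \<nu> (NotF M p) \<longleftrightarrow> \<not> true_under \<nu> p"
    "true_under \<nu> (AndF M p q) \<longleftrightarrow> true_under \<nu> p \<and> true_under \<nu> q"
    "true_under \<nu> (OrF M p q) \<longleftrightarrow> true_under \<nu> p \<or> true_under \<nu> q"
proof -
  obtain V where V: "V \<in> \<S>" "evaluation M \<nu> V" using evaluation_exists assms by blast
  note * = true_under_iff[OF V(2,1)]
  show "true_under \<nu> (AtomF M a) \<longleftrightarrow> a \<in> \<nu>"
    "true_under \<nu> (NotF M p) \<longleftrightarrow> \<not> true_under \<nu> p"
    "true_under \<nu> (AndF M p q) \<longleftrightarrow> true_under \<nu> p \<and> true_under \<nu> q"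
    "true_under \<nu> (OrF M p q) \<longleftrightarrow> true_under \<nu> p \<or> true_under \<nu> q"
    unfolding * using V(2) by (simp_all add: evaluation_def)
qed

abbreviation bits :: "'a \<Rightarrow> 'a set" where "bits s \<equiv> {i. bit M s i}"

lemma decidable_true_under_bits:
  assumes "computable f" "computable g" shows "decidable (\<lambda>x. true_under (bits (f x)) (g x))"
proof -
  have "decidable2 (bit M)" unfolding decidable2_def by (intro decidable_bit computable_intros)
  then obtain V where V: "V \<in> \<S>" "\<And>s. evaluation M (bits s) {p. \<langle>s, p\<rangle> \<in> V}"
    using evaluations_exist by blast
  have "true_under (bits s) p \<longleftrightarrow> \<langle>s, p\<rangle> \<in> V" for s p
    using true_under_iff[OF V(2) section_in_Sets[OF V(1)]] by simp
  moreover have "decidable (\<lambda>x. \<langle>f x, g x\<rangle> \<in> V)" by (intro decidable_Mem V computable_pair assms)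
  ultimately show ?thesis by simp
qed

section \<open>From weak Koenig's lemma to satisfiability\<close>

lemma decidable_set: "decidable P \<Longrightarrow> {x. P x} \<in> \<S>"
  by (simp add: decidable_def)

lemma restrict_in_tree:
  assumes T: "binary_tree M T" and t: "t \<in> T" "l \<preceq> length_of t"
  obtains u where "u \<in> T" "u \<in> strings M" "length_of u = l" "\<And>i. i \<prec> l \<Longrightarrow> bit M u i \<longleftrightarrow> bit M t i"
proof -
  have "t \<in> strings M" using T t(1) unfolding binary_tree_def by blast
  then obtain u where u: "initial_segment M u t" "length_of u = l"
    using restriction_exists t(2) by blast
  then have "u \<in> T" using T t(1) unfolding binary_tree_def by blast
  then show thesis using that u unfolding initial_segment_def by simp
qed

text \<open>
  The function \<open>nx\<close> maps \<open>i\<close> to the next element of \<open>X\<close>.  Unlike the increasing enumeration of \<open>X\<close> it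
  needs no recursion.  It is not injective, but all positions with the same image carry the same bit.
\<close>

lemma RWKL_localized:
  assumes "RWKL M"
    and T: "T \<in> \<S>" "binary_tree M T" "unbounded M T" and X: "X \<in> \<S>" "unbounded M X"
  shows "\<exists>H\<in>\<S>. H \<subseteq> X \<and> unbounded M H \<and> homogeneous_tree M H T"
proof -
  define nx where "nx i = arith.Least (\<lambda>x. x \<in> X \<and> i \<preceq> x)" for i
  have dec: "decidable2 (\<lambda>i x. x \<in> X \<and> i \<preceq> x)"
    unfolding decidable2_def by (intro decidable_intros computable_intros X)
  have ex: "\<exists>x. x \<in> X \<and> i \<preceq> x" for i using X(2) unfolding unbounded_def by blast
  have comp: "computable nx" unfolding nx_def by (intro computable_Least dec ex)
  have nx: "nx i \<in> X" "i \<preceq> nx i" "\<And>x. x \<in> X \<Longrightarrow> i \<preceq> x \<Longrightarrow> nx i \<preceq> x" for i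
    using decidable_Least[OF decidable2_section[OF dec]] ex unfolding nx_def by blast+
  have nx_mono: "nx i \<preceq> nx j" if "i \<preceq> j" for i j
    by (rule nx(3)[OF nx(1)]) (rule arith.order_trans[OF that nx(2)])
  \<comment> \<open>The string \<open>t\<close> has to end at \<open>nx |s|\<close>: then its bit at \<open>nx i\<close> exists only if \<open>i < |s|\<close>, where \<open>s\<close> controls it.\<close>
  define reads where "reads s t \<longleftrightarrow> t \<in> T \<and> length_of t = nx (length_of s) \<and>
      (\<forall>i. i \<prec> length_of s \<longrightarrow> nx i \<prec> length_of t \<longrightarrow> (bit M s i \<longleftrightarrow> bit M t (nx i)))" for s t
  define S where "S = {s. s \<in> strings M \<and> (\<exists>t. t \<prec> string_bound (nx (length_of s)) \<oplus> \<one> \<and> reads s t)}"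
  have "S \<in> \<S>" unfolding S_def reads_def
    by (intro decidable_set decidable_intros decidable_strings decidable_bit computable_string_bound
        computable_compose[OF comp] computable_len computable_intros T)
  have S_iff: "s \<in> S \<longleftrightarrow> s \<in> strings M \<and> (\<exists>t. reads s t)" for s
  proof -
    have "t \<prec> string_bound (nx (length_of s)) \<oplus> \<one>" if "reads s t" for t
      using that T(2) string_le_bound[of t] unfolding reads_def binary_tree_def less_add_one_iff by auto
    then show ?thesis by (auto simp: S_def)
  qed
  have "binary_tree M S"
    unfolding binary_tree_def
  proof (intro conjI ballI allI impI)
    show "S \<subseteq> strings M" by (auto simp: S_def)
    fix s s' assume s: "s \<in> S" "initial_segment M s' s"
    then have s': "s' \<in> strings M" "length_of s' \<preceq> length_of s"
      "\<And>i. i \<prec> length_of s' \<Longrightarrow> bit M s' i \<longleftrightarrow> bit M s i" by (simp_all add: initial_segment_def)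
    obtain t where t: "reads s t" using s S_iff by blast
    have "nx (length_of s') \<preceq> length_of t" using t nx_mono[OF s'(2)] by (simp add: reads_def)
    moreover have "t \<in> T" using t by (simp add: reads_def)
    ultimately obtain u where u: "u \<in> T" "length_of u = nx (length_of s')"
      "\<And>i. i \<prec> nx (length_of s') \<Longrightarrow> bit M u i \<longleftrightarrow> bit M t i"
      using restrict_in_tree[OF T(2)] by metis
    have "bit M s' i \<longleftrightarrow> bit M u (nx i)" if i: "i \<prec> length_of s'" "nx i \<prec> length_of u" for i
    proof -
      have "i \<prec> length_of s" using i(1) s'(2) by (rule arith.less_le_trans)
      moreover have "nx i \<prec> length_of t"
        using i(2) u(2) \<open>nx (length_of s') \<preceq> length_of t\<close> arith.less_le_trans by metis
      ultimately show ?thesis using t i u(2,3) s'(3) unfolding reads_def by simp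
    qed
    then have "reads s' u" using u by (simp add: reads_def)
    then show "s' \<in> S" using s' S_iff by blast
  qed
  moreover have "unbounded M S"
  proof (rule unboundedI_lengths)
    fix l
    obtain t where t: "t \<in> T" "length_of t = nx l" using tree_has_all_lengths[OF T(2,3)] by blast
    have "{i. bit M t (nx i)} \<in> \<S>"
      by (intro decidable_set decidable_bit computable_const comp)
    then obtain s where s: "s \<in> strings M" "length_of s = l"
      "\<And>i. bit M s i \<longleftrightarrow> i \<prec> l \<and> i \<in> {i. bit M t (nx i)}" by (rule string_obtain) (rule that)
    have "reads s t" unfolding reads_def using t s by simp
    then show "\<exists>s\<in>S. l \<preceq> length_of s" using s(1,2) S_iff by auto
  qed
  ultimately obtain H0 where H0: "H0 \<in> \<S>" "unbounded M H0" "homogeneous_tree M H0 S"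
    using \<open>RWKL M\<close> \<open>S \<in> \<S>\<close> unfolding RWKL_def by blast
  obtain c where c: "\<And>l. \<exists>s\<in>S. length_of s = l \<and> (\<forall>i\<in>H0. i \<prec> l \<longrightarrow> bit M s i = c)"
    using homogeneous_treeD[OF \<open>binary_tree M S\<close> H0(3)] by blast
  define H where "H = {x. \<exists>i. i \<prec> x \<oplus> \<one> \<and> i \<in> H0 \<and> nx i = x}"
  have H_iff: "x \<in> H \<longleftrightarrow> (\<exists>i\<in>H0. x = nx i)" for x
    unfolding H_def less_add_one_iff using nx(2) by blast
  have "H \<in> \<S>" unfolding H_def
    by (intro decidable_set decidable_intros computable_compose[OF comp] computable_intros H0)
  moreover have "H \<subseteq> X" by (auto simp: H_iff nx(1))
  moreover have "unbounded M H"
    unfolding unbounded_def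
  proof
    fix k
    obtain i where i: "i \<in> H0" "k \<preceq> i" using H0(2) unfolding unbounded_def by blast
    then have "nx i \<in> H" "k \<preceq> nx i" using H_iff arith.order_trans[OF i(2) nx(2)] by blast+
    then show "\<exists>x\<in>H. k \<preceq> x" by blast
  qed
  moreover have "homogeneous_tree M H T"
    unfolding homogeneous_tree_def
  proof (rule unboundedI_lengths)
    fix l
    obtain s where s: "s \<in> S" "length_of s = l" "\<And>i. i \<in> H0 \<Longrightarrow> i \<prec> l \<Longrightarrow> bit M s i = c" using c by blast
    obtain t where t: "reads s t" using s S_iff by blast
    have "bit M t x = c" if x: "x \<in> H" "x \<prec> length_of t" for x
    proof -
      obtain i where i: "i \<in> H0" "x = nx i" using x(1) H_iff by blast
      have "i \<prec> l"
      proof (rule ccontr)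
        assume "\<not> i \<prec> l"
        then have "nx l \<preceq> x" unfolding i(2) by (intro nx_mono) simp
        then show False using x(2) t s(2) unfolding reads_def by simp
      qed
      then have "bit M s i \<longleftrightarrow> bit M t x" using t x(2) i(2) s(2) unfolding reads_def by simp
      with s(3)[OF i(1) \<open>i \<prec> l\<close>] show ?thesis by simp
    qed
    then have "homogeneous_string M H t" unfolding homogeneous_string_def by blast
    moreover have "t \<in> T" "l \<preceq> length_of t" using t s(2) nx(2) by (simp_all add: reads_def)
    ultimately show "\<exists>t\<in>{t \<in> T. homogeneous_string M H t}. l \<preceq> length_of t" by blast
  qed
  ultimately show ?thesis by blast
qed

lemma RWKL_imp_re_LRSAT: assumes "RWKL M" shows "re_LRSAT M"
  unfolding re_LRSAT_def
proof (intro allI impI ballI)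
  fix F X
  assume F: "sequence M F \<and> list_satisfiable M F \<and> atoms M (terms M F) \<in> \<S> \<and> unbounded M (atoms M (terms M F))"
    and "X \<in> \<S>" and X: "unbounded M X \<and> X \<subseteq> atoms M (terms M F)"
  have "F \<in> \<S>" and F_fun: "\<And>i. \<exists>!p. \<langle>i, p\<rangle> \<in> F" using F by (simp_all add: sequence_def)
  define T where "T = {s. s \<in> strings M \<and> (\<forall>p. p \<prec> length_of s \<longrightarrow>
      (\<exists>i. i \<prec> length_of s \<and> \<langle>i, p\<rangle> \<in> F) \<longrightarrow> true_under (bits s) p)}"
  have "T \<in> \<S>" unfolding T_def
    by (intro decidable_set decidable_intros decidable_strings decidable_true_under_bits
        computable_len computable_intros \<open>F \<in> \<S>\<close>)
  moreover have T: "binary_tree M T"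
    unfolding binary_tree_def
  proof (intro conjI ballI allI impI)
    show "T \<subseteq> strings M" by (auto simp: T_def)
    fix s s' assume s: "s \<in> T" "initial_segment M s' s"
    then have s': "s' \<in> strings M" "length_of s' \<preceq> length_of s"
      "\<And>i. i \<prec> length_of s' \<Longrightarrow> bit M s' i \<longleftrightarrow> bit M s i" by (simp_all add: initial_segment_def)
    have "true_under (bits s') p" if p: "p \<prec> length_of s'" "i \<prec> length_of s'" "\<langle>i, p\<rangle> \<in> F" for p i
    proof -
      have "true_under (bits s) p" using s(1) p s'(2) arith.less_le_trans unfolding T_def by blast
      then show ?thesis
        using true_under_agree[OF bits_in_Sets[of s'] bits_in_Sets[of s], of "length_of s'" p] s'(3) p(1) by simp
    qed
    then show "s' \<in> T" using s'(1) unfolding T_def by blast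
  qed
  moreover have "unbounded M T"
  proof (rule unboundedI_lengths)
    fix l
    obtain \<nu> where \<nu>: "\<nu> \<in> \<S>" "satisfies M \<nu> (terms_below M F l)"
      using F unfolding list_satisfiable_def satisfiable_def by blast
    obtain s where s: "s \<in> strings M" "length_of s = l" "\<And>i. bit M s i \<longleftrightarrow> i \<prec> l \<and> i \<in> \<nu>"
      using \<nu>(1) by (rule string_obtain) (rule that)
    have "true_under (bits s) p" if p: "p \<prec> l" "i \<prec> l" "\<langle>i, p\<rangle> \<in> F" for p i
    proof -
      have "true_under \<nu> p" using \<nu>(2) p unfolding satisfies_iff terms_below_def by blast
      then show ?thesis
        using true_under_agree[OF bits_in_Sets[of s] \<nu>(1), of l p] s(3) p(1) by simp
    qed
    then have "s \<in> T" unfolding T_def using s(1,2) by blast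
    then show "\<exists>s\<in>T. l \<preceq> length_of s" using s(2) by auto
  qed
  ultimately obtain H where H: "H \<in> \<S>" "H \<subseteq> X" "unbounded M H" "homogeneous_tree M H T"
    using RWKL_localized[OF assms _ _ _ \<open>X \<in> \<S>\<close>] X by blast
  obtain c where c: "\<And>l. \<exists>s\<in>T. length_of s = l \<and> (\<forall>i\<in>H. i \<prec> l \<longrightarrow> bit M s i = c)"
    using homogeneous_treeD[OF T H(4)] by blast
  have "\<exists>\<nu>\<in>\<S>. satisfies M \<nu> (terms_below M F n) \<and> constant_on H \<nu> c" for n
  proof -
    have "decidable2 (\<lambda>i p. \<langle>i, p\<rangle> \<in> F)"
      unfolding decidable2_def by (intro decidable_intros computable_intros \<open>F \<in> \<S>\<close>)
    then obtain b where b: "\<And>i. i \<prec> n \<Longrightarrow> \<exists>p. p \<prec> b \<and> \<langle>i, p\<rangle> \<in> F"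
      using bounded_choice[of "\<lambda>i p. \<langle>i, p\<rangle> \<in> F" n] F_fun by blast
    obtain s where s: "s \<in> T" "length_of s = n \<oplus> b" "\<And>i. i \<in> H \<Longrightarrow> i \<prec> n \<oplus> b \<Longrightarrow> bit M s i = c"
      using c by blast
    \<comment> \<open>Beyond the end of the string the assignment takes the colour of \<open>H\<close>, so as to be constant on all of \<open>H\<close>.\<close>
    define \<nu> where "\<nu> = {a. a \<prec> n \<oplus> b \<and> bit M s a \<or> \<not> a \<prec> n \<oplus> b \<and> c}"
    have "\<nu> \<in> \<S>" unfolding \<nu>_def
      by (intro decidable_set decidable_intros decidable_bit computable_intros)
    moreover have "true_under \<nu> p" if "p \<in> terms_below M F n" for p
    proof -
      obtain i where i: "i \<prec> n" "\<langle>i, p\<rangle> \<in> F" using \<open>p \<in> terms_below M F n\<close> by (auto simp: terms_below_def)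
      have "p \<prec> b" using b[OF i(1)] i(2) F_fun by blast
      have bounds: "n \<preceq> n \<oplus> b" "b \<preceq> n \<oplus> b" by simp_all
      have "i \<prec> n \<oplus> b" "p \<prec> n \<oplus> b"
        using arith.less_le_trans[OF i(1) bounds(1)] arith.less_le_trans[OF \<open>p \<prec> b\<close> bounds(2)] by blast+
      moreover have "\<forall>p. p \<prec> n \<oplus> b \<longrightarrow> (\<exists>i. i \<prec> n \<oplus> b \<and> \<langle>i, p\<rangle> \<in> F) \<longrightarrow> true_under (bits s) p"
        using s(1) unfolding T_def s(2)[symmetric] by blast
      ultimately have "true_under (bits s) p" using i(2) by blast
      then show ?thesis
        using true_under_agree[OF \<open>\<nu> \<in> \<S>\<close> bits_in_Sets[of s], of "n \<oplus> b" p] \<open>p \<prec> n \<oplus> b\<close>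
        by (simp add: \<nu>_def)
    qed
    moreover have "constant_on H \<nu> c" using s(3) by (auto simp: constant_on_def \<nu>_def)
    ultimately show ?thesis unfolding satisfies_iff by blast
  qed
  then have "list_homogeneous M H F" unfolding list_homogeneous_def by blast
  with H show "\<exists>H\<in>\<S>. unbounded M H \<and> H \<subseteq> X \<and> list_homogeneous M H F" by blast
qed

text \<open>
  The sequence is the identity on \<open>C\<close> and constant elsewhere, so that any part of \<open>C\<close> bounded by \<open>n\<close> is
  contained in the first \<open>n\<close> terms.
\<close>

lemma set_as_list:
  assumes C: "C \<in> \<S>" "C \<noteq> {}"
  obtains F where "sequence M F" "terms M F = C"
    "\<And>n. finite_set M (terms_below M F n)" "\<And>C0. finite_set M C0 \<Longrightarrow> C0 \<subseteq> C \<Longrightarrow> \<exists>n. C0 \<subseteq> terms_below M F n"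
proof -
  obtain p0 where p0: "p0 \<in> C" using C(2) by blast
  define F where "F = {z. first z \<in> C \<and> second z = first z \<or> first z \<notin> C \<and> second z = p0}"
  have F_iff: "\<langle>i, p\<rangle> \<in> F \<longleftrightarrow> p = (if i \<in> C then i else p0)" for i p by (auto simp: F_def)
  have "F \<in> \<S>" unfolding F_def by (intro decidable_set decidable_intros computable_intros C)
  show thesis
  proof
    show "sequence M F" using \<open>F \<in> \<S>\<close> by (simp add: sequence_def F_iff)
    show "terms M F = C" using p0 by (auto simp: terms_def F_iff)
    show "finite_set M (terms_below M F n)" for n
    proof -
      have "terms_below M F n \<in> \<S>" unfolding terms_below_def
        by (intro decidable_set decidable_intros computable_intros \<open>F \<in> \<S>\<close>)
      moreover obtain k where "n \<prec> k" "p0 \<prec> k" using exists_bound3 by blast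
      then have "\<forall>p\<in>terms_below M F n. p \<prec> k"
        using arith.less_trans by (auto simp: terms_below_def F_iff)
      ultimately show ?thesis unfolding finite_set_def by blast
    qed
    show "\<exists>n. C0 \<subseteq> terms_below M F n" if "finite_set M C0" "C0 \<subseteq> C" for C0
      using that unfolding finite_set_def terms_below_def F_iff by (auto split: if_splits)
  qed
qed

lemma set_as_satisfiable_list:
  assumes C: "C \<in> \<S>" "finitely_satisfiable M C" "unbounded M (atoms M C)"
  obtains F where "sequence M F" "terms M F = C" "list_satisfiable M F"
    "\<And>H. list_homogeneous M H F \<Longrightarrow> homogeneous M H C"
proof -
  have "C \<noteq> {}" using C(3) by (auto simp: unbounded_def atoms_def)
  then obtain F where F: "sequence M F" "terms M F = C"
    "\<And>n. finite_set M (terms_below M F n)"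
    "\<And>C0. finite_set M C0 \<Longrightarrow> C0 \<subseteq> C \<Longrightarrow> \<exists>n. C0 \<subseteq> terms_below M F n"
    using set_as_list[OF C(1)] by metis
  have "terms_below M F n \<subseteq> C" for n using F(2) unfolding terms_below_def terms_def by blast
  then have "list_satisfiable M F"
    using C(2) F(3) unfolding list_satisfiable_def finitely_satisfiable_def by blast
  moreover have "homogeneous M H C" if "list_homogeneous M H F" for H
    using that F(4) unfolding list_homogeneous_def homogeneous_def satisfies_def by (meson subsetD)
  ultimately show thesis using F(1,2) that by blast
qed

lemma re_LRSAT_imp_LRSAT: assumes "re_LRSAT M" shows "LRSAT M"
  unfolding LRSAT_def
proof (intro ballI impI)
  fix C X assume "C \<in> \<S>" "X \<in> \<S>" and X: "unbounded M X \<and> X \<subseteq> atoms M C"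
    and C: "finitely_satisfiable M C \<and> atoms M C \<in> \<S> \<and> unbounded M (atoms M C)"
  obtain F where F: "sequence M F" "terms M F = C" "list_satisfiable M F"
    "\<And>H. list_homogeneous M H F \<Longrightarrow> homogeneous M H C"
    using set_as_satisfiable_list \<open>C \<in> \<S>\<close> C by metis
  then show "\<exists>H\<in>\<S>. unbounded M H \<and> H \<subseteq> X \<and> homogeneous M H C"
    using assms C X \<open>X \<in> \<S>\<close> unfolding re_LRSAT_def by metis
qed

lemma re_RSAT_imp_RSAT: assumes "re_RSAT M" shows "RSAT M"
  unfolding RSAT_def
proof (intro ballI impI)
  fix C assume "C \<in> \<S>"
    and C: "finitely_satisfiable M C \<and> atoms M C \<in> \<S> \<and> unbounded M (atoms M C)"
  obtain F where F: "sequence M F" "terms M F = C" "list_satisfiable M F"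
    "\<And>H. list_homogeneous M H F \<Longrightarrow> homogeneous M H C"
    using set_as_satisfiable_list \<open>C \<in> \<S>\<close> C by metis
  then show "\<exists>H\<in>\<S>. unbounded M H \<and> H \<subseteq> atoms M C \<and> homogeneous M H C"
    using assms C unfolding re_RSAT_def by metis
qed

lemma LRSAT_imp_RSAT: "LRSAT M \<Longrightarrow> RSAT M"
  unfolding LRSAT_def RSAT_def by blast

lemma re_LRSAT_imp_re_RSAT: "re_LRSAT M \<Longrightarrow> re_RSAT M"
  unfolding re_LRSAT_def re_RSAT_def by blast

section \<open>From satisfiability to weak Koenig's lemma\<close>

text \<open>
  The formula \<open>q\<close> says that the assignment differs from \<open>s\<close> below \<open>j\<close>.  This is expressed by strings
  of length \<open>q + 1\<close> instead of assignments in order to be decidable; \<open>excludes_iff\<close> gives the intended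
  meaning.  The condition \<open>j \<le> q\<close> ensures that these strings have all the bits that are compared.
\<close>

definition excludes :: "'a \<Rightarrow> 'a \<Rightarrow> 'a \<Rightarrow> bool" where
  "excludes s j q \<longleftrightarrow> j \<preceq> q \<and> (\<forall>t. t \<prec> string_bound (q \<oplus> \<one>) \<oplus> \<one> \<longrightarrow> t \<in> strings M \<longrightarrow> length_of t = q \<oplus> \<one> \<longrightarrow>
     (true_under (bits t) q \<longleftrightarrow> (\<exists>i. i \<prec> j \<and> \<not> (bit M t i \<longleftrightarrow> bit M s i))))"

lemma decidable_excludes:
  assumes "computable f" "computable g" "computable h"
  shows "decidable (\<lambda>x. excludes (f x) (g x) (h x))"
  unfolding excludes_def
  by (intro decidable_intros decidable_strings decidable_bit decidable_true_under_bits
      computable_string_bound computable_len computable_intros computable_compose[OF assms(1)]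
      computable_compose[OF assms(2)] computable_compose[OF assms(3)] assms)

lemma excludes_iff:
  "excludes s j q \<longleftrightarrow> j \<preceq> q \<and> (\<forall>\<nu>\<in>\<S>. true_under \<nu> q \<longleftrightarrow> (\<exists>i. i \<prec> j \<and> \<not> (i \<in> \<nu> \<longleftrightarrow> bit M s i)))"
proof
  assume *: "excludes s j q"
  then have "j \<preceq> q" by (simp add: excludes_def)
  show "j \<preceq> q \<and> (\<forall>\<nu>\<in>\<S>. true_under \<nu> q \<longleftrightarrow> (\<exists>i. i \<prec> j \<and> \<not> (i \<in> \<nu> \<longleftrightarrow> bit M s i)))"
  proof (rule conjI[OF \<open>j \<preceq> q\<close>], rule ballI)
    fix \<nu> assume "\<nu> \<in> \<S>"
    then obtain t where t: "t \<in> strings M" "t \<preceq> string_bound (q \<oplus> \<one>)" "length_of t = q \<oplus> \<one>"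
      "\<And>i. bit M t i \<longleftrightarrow> i \<prec> q \<oplus> \<one> \<and> i \<in> \<nu>" by (rule string_obtain) (rule that)
    have "true_under \<nu> q \<longleftrightarrow> true_under (bits t) q"
      using true_under_agree[OF \<open>\<nu> \<in> \<S>\<close> bits_in_Sets[of t], of "q \<oplus> \<one>" q] t(4) by (simp add: less_add_one)
    also have "\<dots> \<longleftrightarrow> (\<exists>i. i \<prec> j \<and> \<not> (bit M t i \<longleftrightarrow> bit M s i))"
      using * t(1,2,3) unfolding excludes_def less_add_one_iff by blast
    also have "\<dots> \<longleftrightarrow> (\<exists>i. i \<prec> j \<and> \<not> (i \<in> \<nu> \<longleftrightarrow> bit M s i))"
    proof -
      have "bit M t i \<longleftrightarrow> i \<in> \<nu>" if "i \<prec> j" for i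
        using t(4) arith.less_le_trans[OF that \<open>j \<preceq> q\<close>] by (simp add: less_add_one)
      then show ?thesis by blast
    qed
    finally show "true_under \<nu> q \<longleftrightarrow> (\<exists>i. i \<prec> j \<and> \<not> (i \<in> \<nu> \<longleftrightarrow> bit M s i))" .
  qed
next
  assume *: "j \<preceq> q \<and> (\<forall>\<nu>\<in>\<S>. true_under \<nu> q \<longleftrightarrow> (\<exists>i. i \<prec> j \<and> \<not> (i \<in> \<nu> \<longleftrightarrow> bit M s i)))"
  then have "true_under (bits t) q \<longleftrightarrow> (\<exists>i. i \<prec> j \<and> \<not> (bit M t i \<longleftrightarrow> bit M s i))" for t
    using bits_in_Sets[of t] by simp
  with * show "excludes s j q" unfolding excludes_def by blast
qed

text \<open>
  The disjunction of literals is built by \<open>\<Sigma>\<^sup>0\<^sub>1\<close> induction on \<open>j\<close>, starting from a contradiction.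
\<close>

lemma excluding_formula_exists: "\<exists>q. excludes s j q"
proof (rule sigma1_induct[where R="\<lambda>j q. excludes s j q"])
  show "decidable2 (\<lambda>j q. excludes s j q)"
    unfolding decidable2_def by (intro decidable_excludes computable_intros)
  have "excludes s \<zero> (AndF M (AtomF M \<zero>) (NotF M (AtomF M \<zero>)))"
    unfolding excludes_iff by (simp add: true_under_simps not_less_zero)
  then show "\<exists>q. excludes s \<zero> q" ..
  fix j q assume q: "excludes s j q"
  define lit where "lit = (if bit M s j then NotF M (AtomF M j) else AtomF M j)"
  have lit: "true_under \<nu> lit \<longleftrightarrow> \<not> (j \<in> \<nu> \<longleftrightarrow> bit M s j)" if "\<nu> \<in> \<S>" for \<nu>
    using true_under_simps[OF that] by (simp add: lit_def)
  have "j \<oplus> \<one> \<preceq> OrF M q lit"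
    using q subformula_less(5)[of q lit] arith.le_less_trans
    unfolding excludes_iff arith.less_iff_succ_less_eq[symmetric] by blast
  moreover have "true_under \<nu> (OrF M q lit) \<longleftrightarrow> (\<exists>i. i \<prec> j \<oplus> \<one> \<and> \<not> (i \<in> \<nu> \<longleftrightarrow> bit M s i))" if "\<nu> \<in> \<S>" for \<nu>
    using q that unfolding true_under_simps[OF that] lit[OF that] excludes_iff less_add_one by blast
  ultimately have "excludes s (j \<oplus> \<one>) (OrF M q lit)" unfolding excludes_iff by blast
  then show "\<exists>q. excludes s (j \<oplus> \<one>) q" ..
qed

lemma RSAT_imp_RWKL: assumes "RSAT M" shows "RWKL M"
  unfolding RWKL_def
proof (intro ballI impI)
  fix T assume "T \<in> \<S>" and T: "binary_tree M T \<and> unbounded M T"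
  define C where "C = {p. \<forall>t. t \<prec> string_bound (p \<oplus> \<one>) \<oplus> \<one> \<longrightarrow> t \<in> T \<longrightarrow> length_of t = p \<oplus> \<one> \<longrightarrow>
      true_under (bits t) p}"
  have "C \<in> \<S>" unfolding C_def
    by (intro decidable_set decidable_intros decidable_true_under_bits computable_string_bound
        computable_len computable_intros \<open>T \<in> \<S>\<close>)
  have C_iff: "p \<in> C \<longleftrightarrow> (\<forall>t\<in>T. length_of t = p \<oplus> \<one> \<longrightarrow> true_under (bits t) p)" for p
  proof -
    have "t \<prec> string_bound (p \<oplus> \<one>) \<oplus> \<one>" if "t \<in> T" "length_of t = p \<oplus> \<one>" for t
      using that T string_le_bound[of t] unfolding binary_tree_def less_add_one_iff by auto
    then show ?thesis unfolding C_def by blast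
  qed
  have C_true: "true_under (bits t) p" if p: "p \<in> C" "t \<in> T" "p \<prec> length_of t" for p t
  proof -
    have "p \<oplus> \<one> \<preceq> length_of t" using p(3) by (simp add: arith.less_iff_succ_less_eq)
    then obtain u where u: "u \<in> T" "length_of u = p \<oplus> \<one>"
      "\<And>i. i \<prec> p \<oplus> \<one> \<Longrightarrow> bit M u i \<longleftrightarrow> bit M t i"
      using restrict_in_tree[of T t "p \<oplus> \<one>"] T p(2) by metis
    have "true_under (bits u) p" using \<open>p \<in> C\<close> u(1,2) C_iff by blast
    then show ?thesis
      using true_under_agree[OF bits_in_Sets[of u] bits_in_Sets[of t], of "p \<oplus> \<one>" p] u(3)
      by (simp add: less_add_one)
  qed
  have "finitely_satisfiable M C"
    unfolding finitely_satisfiable_def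
  proof (intro allI impI)
    fix C0 assume C0: "finite_set M C0 \<and> C0 \<subseteq> C"
    then obtain k where k: "\<And>p. p \<in> C0 \<Longrightarrow> p \<prec> k" by (auto simp: finite_set_def)
    obtain t where t: "t \<in> T" "length_of t = k" using tree_has_all_lengths T by blast
    then have "satisfies M (bits t) C0" unfolding satisfies_iff using C_true C0 k by blast
    then show "satisfiable M C0" unfolding satisfiable_def using bits_in_Sets[of t] by blast
  qed
  moreover have "atoms M C = UNIV"
  proof -
    have "a \<in> atoms M C" for a
    proof -
      let ?p = "OrF M (AtomF M a) (NotF M (AtomF M a))"
      have "?p \<in> C" using C_iff true_under_simps[OF bits_in_Sets] by simp
      moreover obtain Z where "Z \<in> \<S>" "occurrence_set M a Z" using occurrence_set_exists by blast
      then have "occurs M a ?p" unfolding occurs_def by (intro bexI[of _ Z]) (simp_all add: occurrence_set_def)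
      ultimately show ?thesis unfolding atoms_def by blast
    qed
    then show ?thesis by blast
  qed
  moreover have "UNIV \<in> \<S>" using decidable_set[OF decidable_const[of True]] by simp
  moreover have "unbounded M UNIV" unfolding unbounded_def by auto
  ultimately obtain H where H: "H \<in> \<S>" "unbounded M H" "homogeneous M H C"
    using assms \<open>C \<in> \<S>\<close> unfolding RSAT_def by metis
  obtain c where c: "\<And>C0. finite_set M C0 \<Longrightarrow> C0 \<subseteq> C \<Longrightarrow> \<exists>\<nu>\<in>\<S>. satisfies M \<nu> C0 \<and> constant_on H \<nu> c"
    using H(3) unfolding homogeneous_def by blast
  have "homogeneous_tree M H T"
    unfolding homogeneous_tree_def
  proof (rule unboundedI_lengths)
    fix n
    have "decidable2 (\<lambda>s q. excludes s (length_of s) q)"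
      unfolding decidable2_def by (intro decidable_excludes computable_len computable_intros)
    then obtain b where b: "\<And>s. s \<preceq> string_bound n \<Longrightarrow> \<exists>q. q \<prec> b \<and> excludes s (length_of s) q"
      using bounded_choice[of "\<lambda>s q. excludes s (length_of s) q" "string_bound n \<oplus> \<one>"]
        excluding_formula_exists unfolding less_add_one_iff by blast
    define C0 where "C0 = {p. p \<prec> b \<and> p \<in> C}"
    have "C0 \<in> \<S>" unfolding C0_def by (intro decidable_set decidable_intros computable_intros \<open>C \<in> \<S>\<close>)
    then have "finite_set M C0" "C0 \<subseteq> C" by (auto simp: finite_set_def C0_def)
    then obtain \<nu> where \<nu>: "\<nu> \<in> \<S>" "satisfies M \<nu> C0" "constant_on H \<nu> c" using c by blast
    obtain s where s: "s \<in> strings M" "s \<preceq> string_bound n" "length_of s = n" "\<And>i. bit M s i \<longleftrightarrow> i \<prec> n \<and> i \<in> \<nu>"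
      using \<nu>(1) by (rule string_obtain) (rule that)
    have "s \<in> T"
    proof (rule ccontr)
      assume "s \<notin> T"
      obtain q where q: "q \<prec> b" "excludes s n q" using b s(2,3) by blast
      have "true_under (bits t) q" if t: "t \<in> T" "length_of t = q \<oplus> \<one>" for t
      proof (rule ccontr)
        assume "\<not> true_under (bits t) q"
        then have "bit M s i \<longleftrightarrow> bit M t i" if "i \<prec> n" for i
          using q(2) bits_in_Sets[of t] that unfolding excludes_iff by blast
        moreover have "n \<preceq> length_of t"
          using q(2) t(2) unfolding excludes_iff by (simp add: leq_def less_add_one)
        ultimately have "initial_segment M s t"
          using s(1,3) t(1) T unfolding initial_segment_def binary_tree_def by blast
        then show False using \<open>s \<notin> T\<close> t(1) T unfolding binary_tree_def by blast
      qed
      then have "q \<in> C0" using q(1) C_iff by (simp add: C0_def)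
      then have "true_under \<nu> q" using \<nu>(2) unfolding satisfies_iff by blast
      then show False using q(2) \<nu>(1) s(4) unfolding excludes_iff by blast
    qed
    moreover have "bit M s i = c" if "i \<in> H" "i \<prec> length_of s" for i
      using that \<nu>(3) s(3,4) unfolding constant_on_def by simp
    then have "homogeneous_string M H s" unfolding homogeneous_string_def by blast
    ultimately show "\<exists>s\<in>{s \<in> T. homogeneous_string M H s}. n \<preceq> length_of s" using s(3) by auto
  qed
  with H show "\<exists>H\<in>\<S>. unbounded M H \<and> homogeneous_tree M H T" by blast
qed

end

theorem theorem4p7:
  fixes M :: "'a l2_structure"
  assumes "RCA0 M"
  shows "(RWKL M \<longleftrightarrow> RSAT M) \<and> (RWKL M \<longleftrightarrow> LRSAT M) \<and>
         (RWKL M \<longleftrightarrow> re_RSAT M) \<and> (RWKL M \<longleftrightarrow> re_LRSAT M)"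
proof -
  interpret rca0_model M using assms by unfold_locales
  show ?thesis
    using RWKL_imp_re_LRSAT re_LRSAT_imp_LRSAT LRSAT_imp_RSAT re_LRSAT_imp_re_RSAT re_RSAT_imp_RSAT
      RSAT_imp_RWKL by blast
qed

end
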